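(* Let $(c_i)_{i\in\mathbb{Z}}$ and $(d_i)_{i\in\mathbb{Z}}$ be independent commuting formal variables, let $\alpha,\beta\in\mathbb{Z}$, and consider the $\widehat{GL_3}$ tau-functions $\tau_{k,\ell}^{(\alpha,\beta)}$ in the case that the series $E^{(\beta)}(z)$ is $0$. For integers $k\ge\ell\ge 0$ let $$p_{k,\ell}^{(\alpha,\beta)}(z)=\frac{1}{\tau_{k,\ell}^{(\alpha,\beta)}}\,z^k\,S_c^{+}(z)S_d^{+}(z)\tau_{k,\ell}^{(\alpha,\beta)},$$ and for polynomials $f,g$ in $z$ let $$\langle f(z),g(z)\rangle_C=\operatorname{Res}_z\Bigl(\sum_{i=0}^{\infty}\frac{c_{\alpha-\beta+i}}{z^{i+1}}f(z)g(z)\Bigr),\qquad \langle f(z),g(z)\rangle_D=\operatorname{Res}_z\Bigl(\sum_{i=0}^{\infty}\frac{d_{\alpha+i}}{z^{i+1}}f(z)g(z)\Bigr).$$ Then $p_{k,\ell}^{(\alpha,\beta)}(z)$ is a monic polynomial in $z$ of degree $k$, and $$\langle p_{k,\ell}^{(\alpha,\beta)}(z),z^n\rangle_C=0\quad\text{for } 0\le n<k-\ell,\qquad \langle p_{k,\ell}^{(\alpha,\beta)}(z),z^n\rangle_D=0\quad\text{for } 0\le n<\ell ;$$ that is, the $p_{k,\ell}^{(\alpha,\beta)}$ are type II multiple orthogonal polynomials.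
   Context: Let $K=\mathbb{C}(c_i,d_i : i\in\mathbb{Z})$; polynomials in $z$ have coefficients in $K$. $\operatorname{Res}_z$ denotes the coefficient of $z^{-1}$. Put $C^{(\gamma)}(z)=\sum_{i\in\mathbb{Z}}c_{i+\gamma}z^{-i-1}$ and $D^{(\gamma)}(z)=\sum_{i\in\mathbb{Z}}d_{i+\gamma}z^{-i-1}$. The $\widehat{GL_3}$ tau-functions $\tau_{k,\ell}^{(\alpha,\beta)}$ are the matrix elements $\langle g\cdot v_0,T_1^kT_2^\ell v_0\rangle$ on three-component fermionic Fock space, where $v_0$ is the vacuum vector, $g$ is a lift to the central extension $\widehat{GL_3}$ of the loop group of $$\begin{bmatrix}1&0&0\\ C^{(\alpha-\beta)}(z)&1&0\\ D^{(\alpha)}(z)&E^{(\beta)}(z)&1\end{bmatrix},$$ and $T_1,T_2$ are lifts of $\mathrm{diag}(z,z^{-1},1)$ and $\mathrm{diag}(1,z,z^{-1})$. When $E^{(\beta)}(z)=0$ they are given explicitly, for $k\ge\ell\ge0$, by $$\tau_{k,\ell}^{(\alpha,\beta)}=\frac{1}{(k-\ell)!\,\ell!}\operatorname{Res}_{\mathbf{x}}\operatorname{Res}_{\mathbf{y}}\Bigl(\prod_{i=1}^{k-\ell}C^{(\alpha-\beta)}(x_i)\prod_{i=1}^{\ell}D^{(\alpha)}(y_i)\;p_{k-\ell,\ell}\Bigr),$$ where $$p_{k-\ell,\ell}=(-1)^{\frac{\ell(\ell+1)}{2}}\prod_{1\le i<j\le k-\ell}(x_i-x_j)^2\prod_{1\le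 i<j\le \ell}(y_i-y_j)^2\prod_{i=1}^{k-\ell}\prod_{j=1}^{\ell}(x_i-y_j)$$ and $\operatorname{Res}_{\mathbf{x}}$, $\operatorname{Res}_{\mathbf{y}}$ are the iterated residues over $x_1,\dots,x_{k-\ell}$ and $y_1,\dots,y_\ell$. This formula may be taken as the definition of $\tau_{k,\ell}^{(\alpha,\beta)}\in\mathbb{C}[c_i,d_i]_{i\in\mathbb{Z}}$. Since the $c_i,d_i$ are independent formal variables, $\tau_{k,\ell}^{(\alpha,\beta)}\neq0$ for $k\ge\ell\ge0$. The shift fields $S_c^{+}(z)$ and $S_d^{+}(z)$ are the commuting $\mathbb{C}[z^{-1}]$-algebra endomorphisms of $\mathbb{C}[c_i,d_i]_{i\in\mathbb{Z}}[z^{-1}]$ with $S_c^{+}(z)c_i=c_i-c_{i+1}/z$, $S_c^{+}(z)d_i=d_i$, and $S_d^{+}(z)d_i=d_i-d_{i+1}/z$, $S_d^{+}(z)c_i=c_i$ for all $i\in\mathbb{Z}$. *)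

theory Defs
  imports
    "HOL.Complex"
    "HOL-Library.Poly_Mapping"
    "HOL-Computational_Algebra.Computational_Algebra"
begin

text \<open>
  The linear order on the indeterminates is mathematically irrelevant; it is what the library
  needs to know that the polynomial ring below is an integral domain, so that its fraction
  field can be formed.
\<close>

datatype cd_var = CVar int | DVar int

instantiation cd_var :: linorder
begin

fun less_eq_cd_var :: "cd_var \<Rightarrow> cd_var \<Rightarrow> bool" where
  "less_eq_cd_var (CVar i) (CVar j) = (i \<le> j)"
| "less_eq_cd_var (CVar i) (DVar j) = True"
| "less_eq_cd_var (DVar i) (CVar j) = False"
| "less_eq_cd_var (DVar i) (DVar j) = (i \<le> j)"

definition less_cd_var :: "cd_var \<Rightarrow> cd_var \<Rightarrow> bool" where
  "less_cd_var u v \<longleftrightarrow> u \<le> v \<and> \<not> v \<le> u"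

instance
proof
  fix u v w :: cd_var
  show "u < v \<longleftrightarrow> u \<le> v \<and> \<not> v \<le> u" by (rule less_cd_var_def)
  show "u \<le> u" by (cases u) auto
  show "u \<le> v \<Longrightarrow> v \<le> w \<Longrightarrow> u \<le> w" by (cases u; cases v; cases w) auto
  show "u \<le> v \<Longrightarrow> v \<le> u \<Longrightarrow> u = v" by (cases u; cases v) auto
  show "u \<le> v \<or> v \<le> u" by (cases u; cases v) auto
qed

end

text \<open>
  \<open>cd_ring\<close> is $\mathbb{C}[c_i, d_i : i \in \mathbb{Z}]$, represented by finitely supported maps
  from monomials to coefficients, and \<open>cd_field\<close> is $K = \mathbb{C}(c_i, d_i : i \in \mathbb{Z})$.
\<close>

type_synonym cd_ring = "(cd_var \<Rightarrow>\<^sub>0 nat) \<Rightarrow>\<^sub>0 complex"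
type_synonym cd_field = "cd_ring fract"

definition scalar :: "complex \<Rightarrow> cd_ring" where
  "scalar a = Poly_Mapping.single 0 a"

definition indet :: "cd_var \<Rightarrow> cd_ring" where
  "indet v = Poly_Mapping.single (Poly_Mapping.single v 1) 1"

abbreviation c_var :: "int \<Rightarrow> cd_ring" where "c_var i \<equiv> indet (CVar i)"
abbreviation d_var :: "int \<Rightarrow> cd_ring" where "d_var i \<equiv> indet (DVar i)"


subsection \<open>Formal distributions and residues\<close>

text \<open>
  A formal distribution (a formal series that is infinite in both directions) in variables
  \<open>v :: 'v\<close> is given by its coefficients, as a function of the exponent vector. Formal
  distributions cannot be multiplied in general; they can be multiplied by Laurent polynomials,
  and one-variable ones can be multiplied when they are in distinct variables.
\<close>

type_synonym ('v, 'r) fdist = "('v \<Rightarrow>\<^sub>0 int) \<Rightarrow> 'r"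
type_synonym ('v, 'r) laurent_poly = "('v \<Rightarrow>\<^sub>0 int) \<Rightarrow>\<^sub>0 'r"

text \<open>
  $\prod_{v \in V} A_v(v)$, where $A_v(z) = \sum_{n \in \mathbb{Z}} A_{v,n} z^n$; the coefficient
  \<open>A v n\<close> is that of $z^n$.
\<close>

definition fdist_prod :: "'v set \<Rightarrow> ('v \<Rightarrow> int \<Rightarrow> 'r) \<Rightarrow> ('v, 'r::comm_ring_1) fdist" where
  "fdist_prod V A = (\<lambda>e. if Poly_Mapping.keys e \<subseteq> V
     then (\<Prod>v\<in>V. A v (Poly_Mapping.lookup e v)) else 0)"

definition fdist_mult ::
  "('v, 'r) fdist \<Rightarrow> ('v, 'r) laurent_poly \<Rightarrow> ('v, 'r::comm_ring_1) fdist" where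
  "fdist_mult F p = (\<lambda>e. \<Sum>m\<in>Poly_Mapping.keys p. F (e - m) * Poly_Mapping.lookup p m)"

text \<open>The coefficient of $v^{-1}$, which is a distribution not involving \<open>v\<close>.\<close>

definition fdist_res :: "'v \<Rightarrow> ('v, 'r) fdist \<Rightarrow> ('v, 'r::comm_ring_1) fdist" where
  "fdist_res v F =
     (\<lambda>e. if Poly_Mapping.lookup e v = 0 then F (e - Poly_Mapping.single v 1) else 0)"

text \<open>
  After the residues in all variables have been taken, only the constant term is left;
  it is the coefficient at exponent vector \<open>0\<close>.
\<close>

definition iterated_res :: "'v list \<Rightarrow> ('v, 'r) fdist \<Rightarrow> 'r::comm_ring_1" where
  "iterated_res vs F = foldr fdist_res vs F 0"


subsection \<open>The tau-functions for vanishing $E^{(\beta)}$\<close>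

text \<open>The coefficients of $z^n$ in $C^{(\gamma)}(z)$ and $D^{(\gamma)}(z)$; here $n = -i-1$.\<close>

definition C_series :: "int \<Rightarrow> int \<Rightarrow> cd_ring" where
  "C_series \<gamma> n = c_var (- n - 1 + \<gamma>)"

definition D_series :: "int \<Rightarrow> int \<Rightarrow> cd_ring" where
  "D_series \<gamma> n = d_var (- n - 1 + \<gamma>)"

datatype xy_var = XVar nat | YVar nat

definition xy :: "xy_var \<Rightarrow> (xy_var, cd_ring) laurent_poly" where
  "xy v = Poly_Mapping.single (Poly_Mapping.single v 1) 1"

abbreviation x_var :: "nat \<Rightarrow> (xy_var, cd_ring) laurent_poly" where "x_var i \<equiv> xy (XVar i)"
abbreviation y_var :: "nat \<Rightarrow> (xy_var, cd_ring) laurent_poly" where "y_var i \<equiv> xy (YVar i)"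

definition p_kernel :: "nat \<Rightarrow> nat \<Rightarrow> (xy_var, cd_ring) laurent_poly" where
  "p_kernel m l = (-1) ^ (l * (l + 1) div 2)
     * (\<Prod>(i, j)\<in>{(i, j). 1 \<le> i \<and> i < j \<and> j \<le> m}. (x_var i - x_var j)\<^sup>2)
     * (\<Prod>(i, j)\<in>{(i, j). 1 \<le> i \<and> i < j \<and> j \<le> l}. (y_var i - y_var j)\<^sup>2)
     * (\<Prod>i=1..m. \<Prod>j=1..l. x_var i - y_var j)"

definition CD_series :: "int \<Rightarrow> int \<Rightarrow> xy_var \<Rightarrow> int \<Rightarrow> cd_ring" where
  "CD_series \<alpha> \<beta> v = (case v of XVar i \<Rightarrow> C_series (\<alpha> - \<beta>) | YVar i \<Rightarrow> D_series \<alpha>)"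

text \<open>To be used only for \<open>l \<le> k\<close>, so that \<open>k - l\<close> is not truncated.\<close>

definition tau :: "int \<Rightarrow> int \<Rightarrow> nat \<Rightarrow> nat \<Rightarrow> cd_ring" where
  "tau \<alpha> \<beta> k l = scalar (1 / (fact (k - l) * fact l)) *
     iterated_res (map XVar [1..<Suc (k - l)] @ map YVar [1..<Suc l])
       (fdist_mult (fdist_prod (XVar ` {1..k - l} \<union> YVar ` {1..l}) (CD_series \<alpha> \<beta>))
          (p_kernel (k - l) l))"


subsection \<open>Shift fields\<close>

text \<open>
  The variable of the type \<open>cd_ring poly\<close> stands for $z^{-1}$. \<open>subst_hom \<phi>\<close> is the
  $\mathbb{C}[z^{-1}]$-algebra endomorphism of $\mathbb{C}[c_i, d_i]_{i \in \mathbb{Z}}[z^{-1}]$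
  that sends each indeterminate \<open>v\<close> to \<open>\<phi> v\<close>.
\<close>

definition subst_monom :: "(cd_var \<Rightarrow> cd_ring poly) \<Rightarrow> (cd_var \<Rightarrow>\<^sub>0 nat) \<Rightarrow> cd_ring poly" where
  "subst_monom \<phi> m = (\<Prod>v\<in>Poly_Mapping.keys m. \<phi> v ^ Poly_Mapping.lookup m v)"

definition subst_coeff :: "(cd_var \<Rightarrow> cd_ring poly) \<Rightarrow> cd_ring \<Rightarrow> cd_ring poly" where
  "subst_coeff \<phi> f =
     (\<Sum>m\<in>Poly_Mapping.keys f. [:scalar (Poly_Mapping.lookup f m):] * subst_monom \<phi> m)"

definition subst_hom :: "(cd_var \<Rightarrow> cd_ring poly) \<Rightarrow> cd_ring poly \<Rightarrow> cd_ring poly" where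
  "subst_hom \<phi> q = (\<Sum>n\<le>degree q. subst_coeff \<phi> (coeff q n) * monom 1 n)"

lemma subst_monom_superset:
  assumes "finite V" "Poly_Mapping.keys m \<subseteq> V"
  shows "subst_monom \<phi> m = (\<Prod>v\<in>V. \<phi> v ^ Poly_Mapping.lookup m v)"
  unfolding subst_monom_def
  by (rule prod.mono_neutral_left) (use assms in \<open>auto simp: in_keys_iff\<close>)

lemma subst_monom_add: "subst_monom \<phi> (m + m') = subst_monom \<phi> m * subst_monom \<phi> m'"
proof -
  let ?V = "Poly_Mapping.keys m \<union> Poly_Mapping.keys m'"
  show ?thesis
    by (simp add: subst_monom_superset[of ?V] Poly_Mapping.keys_add lookup_add power_add
        prod.distrib)
qed

lemma subst_coeff_superset:
  assumes "finite M" "Poly_Mapping.keys f \<subseteq> M"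
  shows "subst_coeff \<phi> f =
    (\<Sum>m\<in>M. [:scalar (Poly_Mapping.lookup f m):] * subst_monom \<phi> m)"
  unfolding subst_coeff_def
  by (rule sum.mono_neutral_left) (use assms in \<open>auto simp: in_keys_iff scalar_def\<close>)

lemma subst_coeff_add: "subst_coeff \<phi> (f + g) = subst_coeff \<phi> f + subst_coeff \<phi> g"
proof -
  let ?M = "Poly_Mapping.keys f \<union> Poly_Mapping.keys g"
  have s: "[:scalar (a + b):] = [:scalar a:] + [:scalar b:]" for a b
    by (simp add: scalar_def single_add)
  show ?thesis
    by (simp add: subst_coeff_superset[of ?M] Poly_Mapping.keys_add lookup_add s
        distrib_right sum.distrib del: add_pCons mult_pCons_left)
qed

lemma subst_coeff_0 [simp]: "subst_coeff \<phi> 0 = 0"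
  by (simp add: subst_coeff_def)

lemma subst_coeff_single:
  "subst_coeff \<phi> (Poly_Mapping.single m a) = [:scalar a:] * subst_monom \<phi> m"
  by (cases "a = 0") (simp_all add: subst_coeff_def scalar_def)

lemma poly_mapping_add_induct:
  assumes "P 0" "\<And>m a. P (Poly_Mapping.single m a)" "\<And>f g. P f \<Longrightarrow> P g \<Longrightarrow> P (f + g)"
  shows "P (f :: 'a \<Rightarrow>\<^sub>0 'b::comm_monoid_add)"
proof (induction f rule: update_induct)
  case const
  then show ?case by (rule assms(1))
next
  case (update f a b)
  have "Poly_Mapping.update a b f = f + Poly_Mapping.single a b"
    using update(1)
    by (intro poly_mapping_eqI) (auto simp: lookup_update lookup_add lookup_single in_keys_iff when_def)
  then show ?case using update assms by simp
qed

lemma subst_coeff_mult: "subst_coeff \<phi> (f * g) = subst_coeff \<phi> f * subst_coeff \<phi> g"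
proof -
  have s: "[:scalar (a * b):] = [:scalar a:] * [:scalar b:]" for a b
    by (simp add: scalar_def mult_single mult.commute)
  have 1: "subst_coeff \<phi> (Poly_Mapping.single m a * g) =
      subst_coeff \<phi> (Poly_Mapping.single m a) * subst_coeff \<phi> g" for m a
    by (induction g rule: poly_mapping_add_induct)
      (simp_all add: mult_single subst_coeff_single subst_monom_add s subst_coeff_add
        distrib_left distrib_right mult_ac del: mult_pCons_left mult_pCons_right)
  show ?thesis
    by (induction f rule: poly_mapping_add_induct)
      (simp_all add: 1 subst_coeff_add distrib_right)
qed

lemma subst_hom_pCons: "subst_hom \<phi> (pCons f q) = subst_coeff \<phi> f + monom 1 1 * subst_hom \<phi> q"
proof (cases "q = 0")
  case True
  then show ?thesis by (simp add: subst_hom_def)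
next
  case False
  then show ?thesis
    by (simp add: subst_hom_def sum.atMost_Suc_shift sum_distrib_left mult.assoc[symmetric] mult_monom
        mult.commute[of "subst_coeff _ _"] del: sum.atMost_Suc)
qed

lemma subst_hom_0 [simp]: "subst_hom \<phi> 0 = 0"
  by (simp add: subst_hom_def)

lemma subst_hom_add: "subst_hom \<phi> (p + q) = subst_hom \<phi> p + subst_hom \<phi> q"
proof (induction p q rule: poly_induct2)
  case (pCons a p b q)
  then show ?case by (simp add: subst_hom_pCons subst_coeff_add algebra_simps)
qed simp

lemma subst_hom_smult: "subst_hom \<phi> (smult f q) = subst_coeff \<phi> f * subst_hom \<phi> q"
  by (induction q) (simp_all add: subst_hom_pCons subst_coeff_mult algebra_simps)

lemma subst_hom_mult: "subst_hom \<phi> (p * q) = subst_hom \<phi> p * subst_hom \<phi> q"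
  by (induction p)
    (simp_all add: subst_hom_pCons subst_hom_add subst_hom_smult algebra_simps)

lemma subst_hom_scalar: "subst_hom \<phi> [:scalar a:] = [:scalar a:]"
  unfolding subst_hom_pCons unfolding scalar_def subst_coeff_single
  by (simp add: scalar_def subst_monom_def)

lemma subst_hom_z_inv: "subst_hom \<phi> (monom 1 1) = monom 1 1"
proof -
  have "subst_coeff \<phi> 1 = 1"
    using subst_coeff_single[of \<phi> 0 1] by (simp add: subst_monom_def scalar_def one_pCons)
  then show ?thesis by (simp add: monom_Suc subst_hom_pCons one_pCons)
qed

lemma subst_hom_indet: "subst_hom \<phi> [:indet v:] = \<phi> v"
  unfolding subst_hom_pCons unfolding indet_def subst_coeff_single
  by (simp add: scalar_def subst_monom_def one_pCons flip: one_pCons)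

definition S_c :: "cd_ring poly \<Rightarrow> cd_ring poly" where
  "S_c = subst_hom (\<lambda>v. case v of CVar i \<Rightarrow> [:c_var i, - c_var (i + 1):] | DVar i \<Rightarrow> [:d_var i:])"

definition S_d :: "cd_ring poly \<Rightarrow> cd_ring poly" where
  "S_d = subst_hom (\<lambda>v. case v of CVar i \<Rightarrow> [:c_var i:] | DVar i \<Rightarrow> [:d_var i, - d_var (i + 1):])"

lemma S_c_indets:
  "S_c [:c_var i:] = [:c_var i, - c_var (i + 1):]" "S_c [:d_var i:] = [:d_var i:]"
  by (simp_all add: S_c_def subst_hom_indet)

lemma S_d_indets:
  "S_d [:d_var i:] = [:d_var i, - d_var (i + 1):]" "S_d [:c_var i:] = [:c_var i:]"
  by (simp_all add: S_d_def subst_hom_indet)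


subsection \<open>Polynomials in $z$ and the two pairings\<close>

text \<open>
  Everything is compared inside $K((z^{-1}))$. Hence the variable \<open>fls_X\<close> of the type
  \<open>cd_field fls\<close> stands for $z^{-1}$, \<open>fls_X_inv\<close> stands for $z$, and the coefficient of
  $z^{-1}$ is the one with index \<open>1\<close>.
\<close>

definition Res_z :: "cd_field fls \<Rightarrow> cd_field" where
  "Res_z F = fls_nth F 1"

text \<open>The inclusions of $K[z]$ and of $\mathbb{C}[c_i, d_i][z^{-1}]$ into $K((z^{-1}))$.\<close>

definition of_poly_z :: "cd_field poly \<Rightarrow> cd_field fls" where
  "of_poly_z f = poly (map_poly fls_const f) fls_X_inv"

definition of_poly_z_inv :: "cd_ring poly \<Rightarrow> cd_field fls" where
  "of_poly_z_inv q = fps_to_fls (fps_of_poly (map_poly to_fract q))"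

definition p_mop :: "int \<Rightarrow> int \<Rightarrow> nat \<Rightarrow> nat \<Rightarrow> cd_field fls" where
  "p_mop \<alpha> \<beta> k l = fls_const (1 / to_fract (tau \<alpha> \<beta> k l)) * fls_X_inv ^ k
     * of_poly_z_inv (S_c (S_d [:tau \<alpha> \<beta> k l:]))"

text \<open>$\sum_{i=0}^\infty a_i z^{-i-1}$\<close>

definition neg_series :: "(nat \<Rightarrow> cd_ring) \<Rightarrow> cd_field fls" where
  "neg_series a = fps_to_fls (fps_X * Abs_fps (\<lambda>i. to_fract (a i)))"

definition pairing_C :: "int \<Rightarrow> int \<Rightarrow> cd_field poly \<Rightarrow> cd_field poly \<Rightarrow> cd_field" where
  "pairing_C \<alpha> \<beta> f g =
     Res_z (neg_series (\<lambda>i. c_var (\<alpha> - \<beta> + int i)) * of_poly_z f * of_poly_z g)"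

definition pairing_D :: "int \<Rightarrow> int \<Rightarrow> cd_field poly \<Rightarrow> cd_field poly \<Rightarrow> cd_field" where
  "pairing_D \<alpha> \<beta> f g =
     Res_z (neg_series (\<lambda>i. d_var (\<alpha> + int i)) * of_poly_z f * of_poly_z g)"

end

theory Submission
  imports Defs "HOL-Combinatorics.Transposition" "HOL-Library.FuncSet"
begin

text \<open>
  Put \<open>m = k - l\<close> and let \<open>L\<close> be the linear functional that sends a monomial
  \<open>x\<^sup>a y\<^sup>b\<close> to \<open>\<Prod>\<^sub>i c(\<alpha> - \<beta> + a\<^sub>i) * \<Prod>\<^sub>j d(\<alpha> + b\<^sub>j)\<close>. Taking the residues turns the definition
  of the tau-function into \<open>\<tau> = s * L(p\<^bsub>m,l\<^esub>)\<close>, where \<open>s = 1 / (m! l!)\<close>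
  (\<open>tau_eq_moment_map\<close>). The shift fields replace each moment \<open>c\<^sub>i\<close>, \<open>d\<^sub>i\<close> by
  \<open>c\<^sub>i - c\<^sub>i\<^sub>+\<^sub>1 / z\<close>, \<open>d\<^sub>i - d\<^sub>i\<^sub>+\<^sub>1 / z\<close>, which multiplies the argument of \<open>L\<close> by
  \<open>\<Prod>\<^sub>v (1 - v / z)\<close>, \<open>v\<close> running over all \<open>k\<close> variables. Hence \<open>z\<^sup>k S\<^sub>c S\<^sub>d \<tau>\<close> is
  \<open>s * L(p\<^bsub>m,l\<^esub> \<Prod>\<^sub>v (z - v))\<close>, a polynomial in \<open>z\<close> of degree at most \<open>k\<close> whose coefficient at \<open>z\<^sup>k\<close>
  is \<open>\<tau>\<close> (\<open>shift_moment_map\<close>, \<open>cd_poly_z_reverse\<close>, \<open>reversed_monomial_top\<close>).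

  To pair this polynomial with \<open>z\<^sup>n\<close> by the \<open>c\<close>-moments is to treat \<open>z\<close> as one more
  variable \<open>w = x\<^sub>m\<^sub>+\<^sub>1\<close>: up to the factor \<open>s\<close>, the result is \<open>L(p\<^bsub>m,l\<^esub> \<Prod>\<^sub>v (w - v) w\<^sup>n)\<close>
  (\<open>pair_moment_reversed_monomial\<close>). One of the two factors \<open>\<Delta>(x\<^sub>1,\<dots>,x\<^sub>m)\<close> of the kernel and
  \<open>\<Prod>\<^sub>i (w - x\<^sub>i)\<close> combine to \<open>\<plusminus>\<Delta>(x\<^sub>1,\<dots>,x\<^sub>m\<^sub>+\<^sub>1)\<close>, so the argument of \<open>L\<close> has the form
  \<open>\<Delta>(x\<^sub>1,\<dots>,x\<^sub>m) w\<^sup>n R\<close> with \<open>R\<close> antisymmetric in \<open>x\<^sub>1,\<dots>,x\<^sub>m\<^sub>+\<^sub>1\<close>. In every monomial of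
  \<open>\<Delta>(x\<^sub>1,\<dots>,x\<^sub>m)\<close> the exponents are \<open>0,\<dots>,m-1\<close> in some order (\<open>vandermonde_exponents\<close>); so
  for \<open>n < m\<close> some \<open>x\<^sub>i\<close> has exponent \<open>n\<close>, exchanging \<open>x\<^sub>i\<close> and \<open>w\<close> fixes the monomial times
  \<open>w\<^sup>n\<close> and changes the sign of \<open>R\<close>, while \<open>L\<close> is symmetric. Hence every term vanishes
  (\<open>moment_map_vandermonde_eq_0\<close>). The \<open>d\<close>-moments are treated in the same way with
  \<open>w = y\<^sub>l\<^sub>+\<^sub>1\<close>.

  It remains to see that \<open>\<tau> \<noteq> 0\<close> (\<open>tau_nonzero\<close>). Substitute for the \<open>c\<close>-moments the power sums
  of the points \<open>l+1,\<dots>,l+m\<close> and for the \<open>d\<close>-moments those of \<open>1,\<dots>,l\<close>. Then \<open>L(p)\<close> becomes the sum of the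
  values of \<open>p\<close> over all assignments of these points to the variables; up to the common sign of
  \<open>p\<^bsub>m,l\<^esub>\<close> all these values are nonnegative, and one of them is positive.
\<close>

section \<open>Vandermonde products\<close>

text \<open>
  The Vandermonde product \<open>\<Prod>\<^bsub>1 \<le> i < j \<le> m\<^esub> (u\<^sub>i - u\<^sub>j)\<close>. The inner range \<open>{1..<j}\<close> makes the
  recursion on \<open>m\<close> split off the factors that contain \<open>u\<^sub>m\<close>.
\<close>

definition vandermonde :: "(nat \<Rightarrow> 'a::comm_ring_1) \<Rightarrow> nat \<Rightarrow> 'a" where
  "vandermonde u m = (\<Prod>j=1..m. \<Prod>i=1..<j. u i - u j)"

text \<open>
  Unital homomorphisms of commutative rings. The substitutions, permutations of variables and
  embeddings below are all instances.
\<close>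

locale comm_ring_1_hom =
  fixes h :: "'a::comm_ring_1 \<Rightarrow> 'b::comm_ring_1"
  assumes add: "h (a + b) = h a + h b"
    and mult: "h (a * b) = h a * h b"
    and one: "h 1 = 1"
begin

lemma zero: "h 0 = 0"
  using add[of 0 0] by simp

lemma uminus: "h (- a) = - h a"
  using add[of a "- a"] by (simp add: zero eq_neg_iff_add_eq_0 add.commute)

lemma diff: "h (a - b) = h a - h b"
  using add[of a "- b"] by (simp add: uminus)

lemma power: "h (a ^ n) = h a ^ n"
  by (induction n) (simp_all add: one mult)

lemma sum: "h (\<Sum>i\<in>I. f i) = (\<Sum>i\<in>I. h (f i))"
  by (induction I rule: infinite_finite_induct) (simp_all add: zero add)

lemma prod: "h (\<Prod>i\<in>I. f i) = (\<Prod>i\<in>I. h (f i))"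
  by (induction I rule: infinite_finite_induct) (simp_all add: one mult)

lemma of_int: "h (of_int n) = of_int n"
proof -
  have nat: "h (of_nat n) = of_nat n" for n by (induction n) (simp_all add: zero add one)
  show ?thesis by (cases n) (simp_all add: nat uminus diff one)
qed

lemma vandermonde: "h (vandermonde u m) = vandermonde (\<lambda>i. h (u i)) m"
  by (simp add: vandermonde_def prod diff)

end

lemma vandermonde_Suc: "vandermonde u (Suc m) = vandermonde u m * (\<Prod>i=1..m. u i - u (Suc m))"
  by (simp add: vandermonde_def atLeastLessThanSuc_atLeastAtMost mult.commute)

lemma vandermonde_pairs:
  "(\<Prod>(i, j)\<in>{(i, j). 1 \<le> i \<and> i < j \<and> j \<le> m}. (u i - u j)\<^sup>2) = (vandermonde u m)\<^sup>2"
proof -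
  have "(vandermonde u m)\<^sup>2 = (\<Prod>j=1..m. \<Prod>i=1..<j. (u i - u j)\<^sup>2)"
    by (simp add: vandermonde_def prod_power_distrib)
  also have "\<dots> = (\<Prod>(j, i)\<in>Sigma {1..m} (\<lambda>j. {1..<j}). (u i - u j)\<^sup>2)"
    by (rule prod.Sigma) auto
  also have "\<dots> = (\<Prod>(i, j)\<in>{(i, j). 1 \<le> i \<and> i < j \<and> j \<le> m}. (u i - u j)\<^sup>2)"
    by (rule prod.reindex_bij_witness[of _ prod.swap prod.swap]) auto
  finally show ?thesis by simp
qed

lemma prod_transpose:
  assumes "a \<in> I" "b \<in> I"
  shows "(\<Prod>i\<in>I. f (transpose a b i)) = (\<Prod>i\<in>I. f i)"
  by (rule prod.reindex_bij_witness[of _ "transpose a b" "transpose a b"])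
    (use assms in \<open>auto simp: transpose_def\<close>)

lemma vandermonde_cong: "(\<And>i. 1 \<le> i \<Longrightarrow> i \<le> m \<Longrightarrow> u i = v i) \<Longrightarrow> vandermonde u m = vandermonde v m"
  unfolding vandermonde_def by (intro prod.cong refl) auto

lemma vandermonde_transpose_less:
  fixes u :: "nat \<Rightarrow> 'a::comm_ring_1"
  assumes "1 \<le> a" "a < b" "b \<le> m"
  shows "vandermonde (\<lambda>i. u (transpose a b i)) m = - vandermonde u m"
  using assms
proof (induction m arbitrary: u a b)
  case (Suc m)
  have low: "vandermonde (\<lambda>i. u (transpose a b i)) (Suc m) = - vandermonde u (Suc m)"
    if "1 \<le> a" "a < b" "b \<le> m" for a b and u :: "nat \<Rightarrow> 'a"
  proof -
    have "transpose a b (Suc m) = Suc m" using that by (auto simp: transpose_def)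
    moreover have "(\<Prod>i=1..m. u (transpose a b i) - u (Suc m)) = (\<Prod>i=1..m. u i - u (Suc m))"
      by (rule prod_transpose[where f = "\<lambda>i. u i - u (Suc m)"]) (use that in auto)
    ultimately show ?thesis by (simp add: vandermonde_Suc Suc.IH[OF that, of u])
  qed
  have adj: "vandermonde (\<lambda>i. u (transpose m (Suc m) i)) (Suc m) = - vandermonde u (Suc m)"
    if m1: "1 \<le> m" for u :: "nat \<Rightarrow> 'a"
  proof -
    obtain r where r: "m = Suc r" using m1 by (cases m) auto
    have "vandermonde (\<lambda>i. u (transpose m (Suc m) i)) r = vandermonde u r"
      by (rule vandermonde_cong) (auto simp: r transpose_def)
    moreover have "(\<Prod>i=1..r. u (transpose m (Suc m) i) - c) = (\<Prod>i=1..r. u i - c)" for c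
      by (rule prod.cong) (auto simp: r transpose_def)
    ultimately show ?thesis by (simp add: r vandermonde_Suc algebra_simps)
  qed
  show ?case
  proof (cases "b \<le> m")
    case True
    then show ?thesis using low Suc.prems by blast
  next
    case False
    then have b: "b = Suc m" using Suc.prems by simp
    show ?thesis
    proof (cases "a = m")
      case True
      show ?thesis unfolding b True by (rule adj) (use True Suc.prems in simp)
    next
      case False
      then have am: "a < m" "1 \<le> m" using Suc.prems b by auto
      \<comment> \<open>\<open>(a m+1) = (m m+1) (a m) (m m+1)\<close> is a product of three transpositions treated above.\<close>
      have "transpose a b i = transpose m (Suc m) (transpose a m (transpose m (Suc m) i))" for i
        using am b by (auto simp: transpose_def)
      then show ?thesis
        using adj[OF am(2), of "\<lambda>i. u (transpose m (Suc m) (transpose a m i))"]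
          low[OF Suc.prems(1) am(1) order.refl, of "\<lambda>i. u (transpose m (Suc m) i)"]
          adj[OF am(2), of u]
        by simp
    qed
  qed
qed simp

lemma vandermonde_transpose:
  assumes "a \<in> {1..m}" "b \<in> {1..m}" "a \<noteq> b"
  shows "vandermonde (\<lambda>i. u (transpose a b i)) m = - vandermonde u m"
  using vandermonde_transpose_less[of a b m u] vandermonde_transpose_less[of b a m u] assms
  by (cases "a < b") (auto simp: transpose_commute)

section \<open>The moment functional\<close>

text \<open>
  The extension of a function \<open>\<Phi>\<close> on monomials to polynomials, with the coefficients
  transported by \<open>h\<close>; it is additive if \<open>h\<close> is.
\<close>

definition lin_ext :: "('r::zero \<Rightarrow> 's::comm_ring_1) \<Rightarrow> ('m \<Rightarrow> 's) \<Rightarrow> ('m \<Rightarrow>\<^sub>0 'r) \<Rightarrow> 's" where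
  "lin_ext h \<Phi> p = (\<Sum>e\<in>Poly_Mapping.keys p. h (Poly_Mapping.lookup p e) * \<Phi> e)"

lemma lin_ext_single: "h 0 = 0 \<Longrightarrow> lin_ext h \<Phi> (Poly_Mapping.single e a) = h a * \<Phi> e"
  by (cases "a = 0") (simp_all add: lin_ext_def)

lemma lin_ext_add:
  assumes "h 0 = 0" "\<And>a b. h (a + b) = h a + h b"
  shows "lin_ext h \<Phi> (p + q) = lin_ext h \<Phi> p + lin_ext h \<Phi> q"
  unfolding lin_ext_def
  by (rule setsum_keys_plus_distrib[where f = "\<lambda>e c. h c *
    \<Phi> e"]) (simp_all add: assms distrib_right)

text \<open>
  \<open>A v n\<close> is the \<open>n\<close>-th moment attached to the variable \<open>v\<close>, so that the monomial with exponents
  \<open>e\<close> is sent to \<open>\<Prod>\<^bsub>v \<in> V\<^esub> A v (e v)\<close>. Variables outside of \<open>V\<close> are ignored, and variables in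
  \<open>V\<close> that do not occur in the monomial contribute their moment of order \<open>0\<close>.
\<close>

definition monomial_value :: "'v set \<Rightarrow> ('v \<Rightarrow> int \<Rightarrow> 'r::comm_ring_1) \<Rightarrow> ('v \<Rightarrow>\<^sub>0 int) \<Rightarrow> 'r" where
  "monomial_value V A e = (\<Prod>v\<in>V. A v (Poly_Mapping.lookup e v))"

text \<open>The linear functional \<open>L\<close> with the moments \<open>A\<close> in the variables \<open>V\<close>.\<close>

definition moment_map :: "'v set \<Rightarrow> ('v \<Rightarrow> int \<Rightarrow> 'r::comm_ring_1) \<Rightarrow> ('v, 'r) laurent_poly \<Rightarrow> 'r" where
  "moment_map V A = lin_ext (\<lambda>c. c) (monomial_value V A)"

lemma moment_map_single: "moment_map V A (Poly_Mapping.single e a) = a * monomial_value V A e"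
  by (simp add: moment_map_def lin_ext_single)

lemma moment_map_add: "moment_map V A (p + q) = moment_map V A p + moment_map V A q"
  by (simp add: moment_map_def lin_ext_add)

lemma moment_map_0 [simp]: "moment_map V A 0 = 0"
  by (simp add: moment_map_def lin_ext_def)

lemma moment_map_uminus: "moment_map V A (- p) = - moment_map V A p"
  using moment_map_add[of V A p "- p"] by (simp add: add_eq_0_iff)

lemma moment_map_diff: "moment_map V A (p - q) = moment_map V A p - moment_map V A q"
  using moment_map_add[of V A p "- q"] by (simp add: moment_map_uminus)

text \<open>
  The hypothesis holds for the powers of a unit; the functional is then the evaluation at a point.
\<close>

lemma moment_map_mult:
  assumes "\<And>v i j. v \<in> V \<Longrightarrow> A v (i + j) = A v i * A v j"
  shows "moment_map V A (p * q) = moment_map V A p * moment_map V A q"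
proof -
  have mv: "monomial_value V A (e + e') = monomial_value V A e * monomial_value V A e'" for e e'
    by (simp add: monomial_value_def lookup_add assms flip: prod.distrib)
  have 1: "moment_map V A (Poly_Mapping.single e a * q) =
    moment_map V A (Poly_Mapping.single e a) * moment_map V A q" for e a
    by (induction q rule: poly_mapping_add_induct)
      (simp_all add: mult_single moment_map_single mv moment_map_add distrib_left mult.assoc
        mult.left_commute)
  show ?thesis
    by (induction p rule: poly_mapping_add_induct)
      (simp_all add: 1 moment_map_add distrib_right)
qed

section \<open>Exchanging two variables\<close>

text \<open>Exchange of the variables \<open>a\<close> and \<open>b\<close>, first on exponent vectors and then on polynomials.\<close>

definition swap_exps :: "'v \<Rightarrow> 'v \<Rightarrow> ('v \<Rightarrow>\<^sub>0 int) \<Rightarrow> ('v \<Rightarrow>\<^sub>0 int)" where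
  "swap_exps a b e = Poly_Mapping.map_key (transpose a b) e"

lemma lookup_swap_exps [simp]:
  "Poly_Mapping.lookup (swap_exps a b e) v = Poly_Mapping.lookup e (transpose a b v)"
  by (simp add: swap_exps_def map_key.rep_eq)

lemma swap_exps_invol [simp]: "swap_exps a b (swap_exps a b e) = e"
  by (rule poly_mapping_eqI) simp

lemma inj_swap_exps: "inj (swap_exps a b)"
  by (rule inj_on_inverseI[where g = "swap_exps a b"]) simp

lemma swap_exps_add: "swap_exps a b (e + e') = swap_exps a b e + swap_exps a b e'"
  by (rule poly_mapping_eqI) (simp add: lookup_add)

definition swap_vars :: "'v \<Rightarrow> 'v \<Rightarrow> ('v, 'r::comm_ring_1) laurent_poly \<Rightarrow> ('v, 'r) laurent_poly" where
  "swap_vars a b p = Poly_Mapping.map_key (swap_exps a b) p"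

lemma lookup_swap_vars: "Poly_Mapping.lookup (swap_vars a b p) e =
  Poly_Mapping.lookup p (swap_exps a b e)"
  by (simp add: swap_vars_def map_key.rep_eq inj_swap_exps)

lemma swap_vars_single: "swap_vars a b (Poly_Mapping.single e c) =
  Poly_Mapping.single (swap_exps a b e) c"
proof (rule poly_mapping_eqI)
  fix k
  have "e = swap_exps a b k \<longleftrightarrow> swap_exps a b e = k" by auto
  then show "Poly_Mapping.lookup (swap_vars a b (Poly_Mapping.single e c)) k =
      Poly_Mapping.lookup (Poly_Mapping.single (swap_exps a b e) c) k"
    by (simp add: lookup_swap_vars lookup_single)
qed

lemma swap_vars_add: "swap_vars a b (p + q) = swap_vars a b p + swap_vars a b q"
  by (rule poly_mapping_eqI) (simp add: lookup_swap_vars lookup_add)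

lemma swap_vars_0 [simp]: "swap_vars a b 0 = 0"
  by (rule poly_mapping_eqI) (simp add: lookup_swap_vars)

lemma swap_vars_mult: "swap_vars a b (p * q) = swap_vars a b p * swap_vars a b q"
proof -
  have 1: "swap_vars a b (Poly_Mapping.single e c * q) =
    swap_vars a b (Poly_Mapping.single e c) * swap_vars a b q" for e c
    by (induction q rule: poly_mapping_add_induct)
      (simp_all add: mult_single swap_vars_single swap_exps_add swap_vars_add distrib_left)
  show ?thesis
    by (induction p rule: poly_mapping_add_induct)
      (simp_all add: 1 swap_vars_add distrib_right)
qed

lemma swap_vars_1 [simp]: "swap_vars a b 1 = 1"
proof -
  have "swap_exps a b 0 = 0" by (rule poly_mapping_eqI) simp
  then show ?thesis using swap_vars_single[of a b 0 1] by simp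
qed

interpretation swap_vars: comm_ring_1_hom "swap_vars a b" for a b
  by unfold_locales (simp_all add: swap_vars_add swap_vars_mult)

lemma swap_vars_xy: "swap_vars a b (xy v) = xy (transpose a b v)"
proof -
  have "swap_exps a b (Poly_Mapping.single v 1) = Poly_Mapping.single (transpose a b v) 1"
    by (rule poly_mapping_eqI) (auto simp: lookup_single when_def transpose_def)
  then show ?thesis by (simp add: xy_def swap_vars_single)
qed

lemma moment_map_swap_vars:
  assumes "a \<in> V" "b \<in> V" "A a = A b"
  shows "moment_map V A (swap_vars a b p) = moment_map V A p"
proof (induction p rule: poly_mapping_add_induct)
  case (2 e c)
  have "monomial_value V A (swap_exps a b e) =
    (\<Prod>v\<in>V. A (transpose a b v) (Poly_Mapping.lookup e (transpose a b v)))"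
    unfolding monomial_value_def by (rule prod.cong) (use assms in \<open>auto simp: transpose_def\<close>)
  also have "\<dots> = monomial_value V A e"
    unfolding monomial_value_def by (rule prod_transpose) (use assms in auto)
  finally show ?case by (simp add: swap_vars_single moment_map_single)
qed (simp_all add: swap_vars_add moment_map_add)

section \<open>Exponents in a Vandermonde product\<close>

text \<open>
  \<open>p\<close> is a polynomial (no negative exponents) whose degree in each variable \<open>v\<close> is at most \<open>d v\<close>;
  in particular it does not involve the variables with \<open>d v = 0\<close>.
\<close>

definition exponents_le :: "('v \<Rightarrow> int) \<Rightarrow> ('v, 'r::comm_ring_1) laurent_poly \<Rightarrow> bool" where
  "exponents_le d p \<longleftrightarrow> (\<forall>e\<in>Poly_Mapping.keys p. \<forall>v. 0 \<le>
    Poly_Mapping.lookup e v \<and> Poly_Mapping.lookup e v \<le> d v)"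

lemma exponents_le_1: "exponents_le (\<lambda>_. 0) 1"
  by (auto simp: exponents_le_def)

lemma exponents_le_mult:
  assumes "exponents_le d p" "exponents_le d' q"
  shows "exponents_le (\<lambda>v. d v + d' v) (p * q)"
  unfolding exponents_le_def
proof (intro ballI allI)
  fix e v assume "e \<in> Poly_Mapping.keys (p * q)"
  then obtain a b where "a \<in> Poly_Mapping.keys p" "b \<in> Poly_Mapping.keys q" "e = a + b"
    using keys_mult by blast
  then show "0 \<le> Poly_Mapping.lookup e v \<and> Poly_Mapping.lookup e v \<le> d v + d' v"
    using assms by (force simp: exponents_le_def lookup_add intro: add_mono)
qed

lemma exponents_le_prod:
  assumes "\<And>i. i \<in> I \<Longrightarrow> exponents_le (d i) (p i)"
  shows "exponents_le (\<lambda>v. \<Sum>i\<in>I. d i v) (\<Prod>i\<in>I. p i)"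
  using assms
  by (induction I rule: infinite_finite_induct) (simp_all add: exponents_le_1 exponents_le_mult)

lemma exponents_le_xy_diff: "exponents_le (\<lambda>w. of_bool (w = u) + of_bool (w = v)) (xy u - xy v)"
proof -
  have "Poly_Mapping.keys (xy u - xy v) \<subseteq> {Poly_Mapping.single u 1, Poly_Mapping.single v 1}"
    by (rule order_trans[OF keys_diff]) (auto simp: xy_def)
  then show ?thesis
    by (auto simp: exponents_le_def lookup_single when_def)
qed

lemma exponents_le_vandermonde:
  assumes "inj x"
  shows "exponents_le (\<lambda>v. if v \<in> x ` {1..m} then int m - 1 else 0) (vandermonde (\<lambda>i. xy (x i)) m)"
proof (induction m)
  case 0
  then show ?case by (simp add: vandermonde_def exponents_le_1)
next
  case (Suc m)
  have s: "(\<Sum>i=1..m. of_bool (v = x i)) = (of_bool (v \<in> x ` {1..m}) :: int)" for v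
  proof (cases "v \<in> x ` {1..m}")
    case True
    then obtain a where a: "v = x a" "a \<in> {1..m}" by auto
    have "(\<Sum>i=1..m. of_bool (v = x i)) = (\<Sum>i=1..m. if a = i then 1 else (0::int))"
      using assms a by (intro sum.cong) (auto simp: inj_eq)
    then show ?thesis using True a by simp
  qed auto
  have "exponents_le (\<lambda>v. \<Sum>i=1..m. of_bool (v = x i) + of_bool (v = x (Suc m)))
     (\<Prod>i=1..m. xy (x i) - xy (x (Suc m)))"
    by (intro exponents_le_prod exponents_le_xy_diff)
  then have "exponents_le (\<lambda>v. of_bool (v \<in> x ` {1..m}) + int m * of_bool (v = x (Suc m)))
     (\<Prod>i=1..m. xy (x i) - xy (x (Suc m)))"
    unfolding sum.distrib s by simp
  from exponents_le_mult[OF Suc this] show ?case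
    unfolding vandermonde_Suc
  proof (rule back_subst[where P = "\<lambda>d. exponents_le d _"], intro ext)
    fix v
    show "(if v \<in> x ` {1..m} then int m - 1 else 0) +
      (of_bool (v \<in> x ` {1..m}) + int m * of_bool (v = x (Suc m))) =
      (if v \<in> x ` {1..Suc m} then int (Suc m) - 1 else 0)"
      using assms by (auto simp: atLeastAtMostSuc_conv inj_eq)
  qed
qed

lemma xy_power: "xy v ^ n = Poly_Mapping.single (Poly_Mapping.single v (int n)) 1"
  by (induction n) (simp_all add: xy_def mult_single single_add[symmetric])

lemma moment_map_sum: "moment_map V A (\<Sum>i\<in>I. f i) = (\<Sum>i\<in>I. moment_map V A (f i))"
  by (induction I rule: infinite_finite_induct) (simp_all add: moment_map_add)

lemma sum_monomials:
  "(\<Sum>e\<in>Poly_Mapping.keys p. Poly_Mapping.single e (Poly_Mapping.lookup p e)) = p"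
proof (rule poly_mapping_eqI)
  fix k
  have "Poly_Mapping.lookup (\<Sum>e\<in>Poly_Mapping.keys p. Poly_Mapping.single e
    (Poly_Mapping.lookup p e)) k
     = (\<Sum>e\<in>Poly_Mapping.keys p. if e = k then Poly_Mapping.lookup p e else 0)"
    by (simp add: lookup_sum lookup_single when_def)
  then show "Poly_Mapping.lookup (\<Sum>e\<in>Poly_Mapping.keys p. Poly_Mapping.single e
    (Poly_Mapping.lookup p e)) k
     = Poly_Mapping.lookup p k"
    by (simp add: in_keys_iff)
qed

text \<open>
  A functional that is symmetric in \<open>a\<close> and \<open>b\<close> takes the product of a symmetric monomial and an
  antisymmetric \<open>R\<close> to its own negative.
\<close>

lemma moment_map_invariant_times_alternating:
  assumes "a \<in> V" "b \<in> V" "A a = A b"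
    and "Poly_Mapping.lookup e a = Poly_Mapping.lookup e b" and R: "swap_vars a b R = - R"
  shows "moment_map V A (Poly_Mapping.single e c * R) = (0 :: cd_ring)"
proof -
  have "swap_exps a b e = e"
    by (rule poly_mapping_eqI) (use assms(4) in \<open>auto simp: transpose_def\<close>)
  then have "swap_vars a b (Poly_Mapping.single e c * R) = - (Poly_Mapping.single e c * R)"
    by (simp add: swap_vars.mult swap_vars_single R)
  then have "moment_map V A (Poly_Mapping.single e c * R) =
    - moment_map V A (Poly_Mapping.single e c * R)"
    using moment_map_swap_vars[of a V b A "Poly_Mapping.single e c * R", OF assms(1-3)]
    by (simp add: moment_map_uminus)
  then show ?thesis
    by simp
qed

lemma transpose_inj: "inj x \<Longrightarrow> transpose (x i) (x j) (x k) = x (transpose i j k)"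
  by (auto simp: transpose_def inj_eq)

lemma swap_vars_vandermonde_xy:
  assumes "inj x" "i \<in> {1..m}" "j \<in> {1..m}" "i \<noteq> j"
  shows "swap_vars (x i) (x j) (vandermonde (\<lambda>k. xy (x k)) m) = - vandermonde (\<lambda>k. xy (x k)) m"
  using vandermonde_transpose[OF assms(2-4), of "\<lambda>k. xy (x k)"]
  by (simp add: swap_vars.vandermonde swap_vars_xy transpose_inj[OF assms(1)])

text \<open>
  Antisymmetry excludes equal exponents, and the degree bound leaves only \<open>m\<close> values for the \<open>m\<close>
  exponents, so each value occurs. The expansion as a determinant is not needed.
\<close>

lemma vandermonde_exponents:
  assumes "inj x" and e: "e \<in> Poly_Mapping.keys (vandermonde (\<lambda>i. xy (x i)) m)"
  shows "(\<lambda>i. Poly_Mapping.lookup e (x i)) ` {1..m} = {0..int m - 1}"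
proof (rule card_subset_eq)
  have le: "0 \<le> Poly_Mapping.lookup e v" "Poly_Mapping.lookup e v \<le>
    (if v \<in> x ` {1..m} then int m - 1 else 0)" for v
    using exponents_le_vandermonde[OF assms(1)] e unfolding exponents_le_def by blast+
  show "(\<lambda>i. Poly_Mapping.lookup e (x i)) ` {1..m} \<subseteq> {0..int m - 1}"
  proof (rule image_subsetI)
    fix i assume "i \<in> {1..m}"
    then show "Poly_Mapping.lookup e (x i) \<in> {0..int m - 1}" using le[of "x i"] by simp
  qed
  have "inj_on (\<lambda>i. Poly_Mapping.lookup e (x i)) {1..m}"
  proof (rule inj_onI, rule ccontr)
    fix i j assume ij: "i \<in> {1..m}" "j \<in> {1..m}" "i \<noteq> j"
      and eq: "Poly_Mapping.lookup e (x i) = Poly_Mapping.lookup e (x j)"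
    have "swap_exps (x i) (x j) e = e"
      by (rule poly_mapping_eqI) (use eq in \<open>auto simp: transpose_def\<close>)
    then have "Poly_Mapping.lookup (vandermonde (\<lambda>i. xy (x i)) m) e
        = - Poly_Mapping.lookup (vandermonde (\<lambda>i. xy (x i)) m) e"
      using swap_vars_vandermonde_xy[OF assms(1) ij] by (metis lookup_swap_vars lookup_uminus)
    then show False using e by (simp add: in_keys_iff)
  qed
  then show "card ((\<lambda>i. Poly_Mapping.lookup e (x i)) ` {1..m}) = card {0..int m - 1}"
    by (simp add: card_image)
qed simp

section \<open>Vanishing of the functional on alternating products\<close>

lemma moment_map_vandermonde_eq_0:
  fixes A :: "xy_var \<Rightarrow> int \<Rightarrow> cd_ring"
  assumes "inj x" "x ` {1..Suc m} \<subseteq> V"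
    and A: "\<And>i. i \<in> {1..m} \<Longrightarrow> A (x i) = A (x (Suc m))"
    and R: "\<And>i. i \<in> {1..m} \<Longrightarrow> swap_vars (x i) (x (Suc m)) R = - R"
    and "n < m"
  shows "moment_map V A (vandermonde (\<lambda>i. xy (x i)) m * xy (x (Suc m)) ^ n * R) = 0"
proof -
  let ?D = "vandermonde (\<lambda>i. xy (x i)) m" and ?w = "x (Suc m)"
  have "moment_map V A (Poly_Mapping.single e c * xy ?w ^ n * R) = 0"
    if e: "e \<in> Poly_Mapping.keys ?D" for e c
  proof -
    have "int n \<in> (\<lambda>i. Poly_Mapping.lookup e (x i)) ` {1..m}"
      using vandermonde_exponents[OF assms(1) e] \<open>n < m\<close> by simp
    then obtain i where i: "i \<in> {1..m}" "Poly_Mapping.lookup e (x i) = int n" by auto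
    have "?w \<notin> x ` {1..m}" using assms(1) by (auto simp: inj_eq)
    moreover have "0 \<le> Poly_Mapping.lookup e ?w"
      "Poly_Mapping.lookup e ?w \<le> (if ?w \<in> x ` {1..m} then int m - 1 else 0)"
      using exponents_le_vandermonde[OF assms(1)] e unfolding exponents_le_def by blast+
    ultimately have "Poly_Mapping.lookup e ?w = 0"
      by (simp only: if_False order_antisym_conv)
    moreover have "x i \<noteq> ?w" using i(1) assms(1) by (auto simp: inj_eq)
    ultimately have "moment_map V A (Poly_Mapping.single (e + Poly_Mapping.single ?w (int n)) c *
      R) = 0"
      using i assms(2) A[OF i(1)]
      by (intro moment_map_invariant_times_alternating[of "x i" V ?w, OF _ _ _ _ R[OF i(1)]])
        (auto simp: lookup_add lookup_single)
    then show ?thesis by (simp add: xy_power mult_single)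
  qed
  then have "moment_map V A ((\<Sum>e\<in>Poly_Mapping.keys ?D. Poly_Mapping.single e
    (Poly_Mapping.lookup ?D e)) * xy ?w ^ n * R) = 0"
    unfolding sum_distrib_right moment_map_sum by simp
  then show ?thesis by (simp only: sum_monomials)
qed

section \<open>Laurent polynomials with integer coefficients\<close>

text \<open>
  The Laurent polynomials in the variables \<open>V\<close> with coefficients in the image of the integers. The
  kernel is one of them, so every ring homomorphism acts on its coefficients in the only
  possible way.
\<close>

inductive int_laurent :: "'v set \<Rightarrow> ('v, 'r::comm_ring_1) laurent_poly \<Rightarrow> bool" for V where
  single: "Poly_Mapping.keys e \<subseteq> V \<Longrightarrow> int_laurent V (Poly_Mapping.single e (of_int n))"
| add: "int_laurent V p \<Longrightarrow> int_laurent V q \<Longrightarrow> int_laurent V (p + q)"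

lemma int_laurent_1: "int_laurent V 1"
  using int_laurent.single[of 0 V 1] by simp

lemma int_laurent_uminus: "int_laurent V p \<Longrightarrow> int_laurent V (- p)"
proof (induction rule: int_laurent.induct)
  case (single e n)
  then show ?case using int_laurent.single[OF single, of "- n"] by (simp add: single_uminus)
next
  case (add p q)
  then show ?case using int_laurent.add[OF add.IH] by simp
qed

lemma int_laurent_diff: "int_laurent V p \<Longrightarrow> int_laurent V q \<Longrightarrow> int_laurent V (p - q)"
  using int_laurent.add[OF _ int_laurent_uminus, of V p q] by simp

lemma int_laurent_mult:
  assumes "int_laurent V p" "int_laurent V q"
  shows "int_laurent V (p * q)"
proof -
  have "int_laurent V (Poly_Mapping.single e (of_int n) * q)" if e: "Poly_Mapping.keys e \<subseteq> V"
    for e n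
    using assms(2)
  proof (induction rule: int_laurent.induct)
    case (single e' n')
    have "Poly_Mapping.keys (e + e') \<subseteq> V" using e single Poly_Mapping.keys_add[of e e'] by blast
    from int_laurent.single[OF this, of "n * n'"] show ?case by (simp add: mult_single)
  qed (simp add: distrib_left int_laurent.add)
  with assms(1) show ?thesis
    by (induction rule: int_laurent.induct) (simp_all add: distrib_right int_laurent.add)
qed

lemma int_laurent_power: "int_laurent V p \<Longrightarrow> int_laurent V (p ^ n)"
  by (induction n) (simp_all add: int_laurent_1 int_laurent_mult)

lemma int_laurent_prod: "(\<And>i. i \<in> I \<Longrightarrow> int_laurent V (p i)) \<Longrightarrow> int_laurent V (\<Prod>i\<in>I. p i)"
  by (induction I rule: infinite_finite_induct) (simp_all add: int_laurent_1 int_laurent_mult)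

lemma int_laurent_xy: "v \<in> V \<Longrightarrow> int_laurent V (xy v)"
  using int_laurent.single[of "Poly_Mapping.single v 1" V 1] by (simp add: xy_def)

lemma int_laurent_lookup: "int_laurent V p \<Longrightarrow> Poly_Mapping.lookup p e \<in> \<int>"
  by (induction rule: int_laurent.induct) (auto simp: lookup_single lookup_add when_def)

lemma int_laurent_keys: "int_laurent V p \<Longrightarrow> e \<in> Poly_Mapping.keys p \<Longrightarrow> Poly_Mapping.keys e \<subseteq> V"
proof (induction arbitrary: e rule: int_laurent.induct)
  case (single e' n)
  then show ?case by (cases "(of_int n :: 'b) = 0") auto
next
  case (add p q)
  then show ?case using Poly_Mapping.keys_add[of p q] by blast
qed

section \<open>Orthogonality relations of the kernel\<close>

text \<open>The variables \<open>x\<^sub>1,\<dots>,x\<^sub>m,y\<^sub>1,\<dots>,y\<^sub>l\<close> of the kernel.\<close>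

definition xy_vars :: "nat \<Rightarrow> nat \<Rightarrow> xy_var set" where
  "xy_vars m l = XVar ` {1..m} \<union> YVar ` {1..l}"

lemma finite_xy_vars [simp]: "finite (xy_vars m l)"
  by (simp add: xy_vars_def)

lemma prod_xy_vars: "(\<Prod>v\<in>xy_vars m l. f v) = (\<Prod>i=1..m. f (XVar i)) * (\<Prod>j=1..l. f (YVar j))"
proof -
  have "inj_on XVar I" "inj_on YVar I" for I by (auto intro: inj_onI)
  then show ?thesis
    unfolding xy_vars_def by (subst prod.union_disjoint) (auto simp: prod.reindex)
qed

lemma card_xy_vars [simp]: "card (xy_vars m l) = m + l"
proof -
  have "inj_on XVar I" "inj_on YVar I" for I by (auto intro: inj_onI)
  then show ?thesis
    unfolding xy_vars_def by (subst card_Un_disjoint) (auto simp: card_image)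
qed

lemma p_kernel_vandermonde:
  "p_kernel m l = (-1) ^ (l * (l + 1) div 2) * (vandermonde x_var m)\<^sup>2 * (vandermonde y_var l)\<^sup>2
     * (\<Prod>i=1..m. \<Prod>j=1..l. x_var i - y_var j)"
  unfolding p_kernel_def vandermonde_pairs ..

lemma int_laurent_p_kernel: "int_laurent (xy_vars m l) (p_kernel m l)"
  unfolding p_kernel_vandermonde vandermonde_def
  by (intro int_laurent_mult int_laurent_power int_laurent_prod int_laurent_diff int_laurent_xy
      int_laurent_uminus int_laurent_1) (auto simp: xy_vars_def)

lemma prod_diff_flip: "(\<Prod>i\<in>I. w - u i) = (-1) ^ card I * (\<Prod>i\<in>I. u i - (w :: 'a :: comm_ring_1))"
proof -
  have "(\<Prod>i\<in>I. w - u i) = (\<Prod>i\<in>I. (-1) * (u i - w))" by simp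
  then show ?thesis by (simp only: prod.distrib prod_constant)
qed

text \<open>
  The new variable \<open>w\<close>, which takes the place of \<open>z\<close>, is the next \<open>x\<close>-variable: it has the same
  moments as the other ones, so that the functional is symmetric in all of them.
\<close>

lemma p_kernel_orthogonal_x:
  fixes A :: "xy_var \<Rightarrow> int \<Rightarrow> cd_ring"
  assumes A: "\<And>i j. A (XVar i) = A (XVar j)" and "n < m"
  defines "w \<equiv> XVar (Suc m)"
  shows "moment_map (insert w (xy_vars m l)) A (p_kernel m l * (\<Prod>v\<in>xy_vars m l. xy w - xy v) *
    xy w ^ n) = 0"
proof -
  define P where "P = (\<Prod>i=1..Suc m. \<Prod>j=1..l. x_var i - y_var j)"
  \<comment> \<open>One of the two Vandermonde factors in the \<open>x\<close>-variables absorbs \<open>\<Prod>\<^sub>i (w - x\<^sub>i)\<close>, and the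
      mixed product absorbs \<open>\<Prod>\<^sub>j (w - y\<^sub>j)\<close>; the other Vandermonde factor is kept.\<close>
  define R where "R = (-1) ^ (l * (l + 1) div 2) * (-1) ^ m * vandermonde x_var (Suc m) *
    (vandermonde y_var l)\<^sup>2 * P"
  have eq: "p_kernel m l * (\<Prod>v\<in>xy_vars m l. xy w - xy v) * xy w ^ n =
    vandermonde x_var m * xy w ^ n * R"
    unfolding p_kernel_vandermonde prod_xy_vars prod_diff_flip[where u = x_var] R_def P_def w_def
    by (simp add: vandermonde_Suc power2_eq_square algebra_simps)
  have "swap_vars (XVar i) w R = - R" if i: "i \<in> {1..m}" for i
  proof -
    have inj: "inj XVar" by (auto intro: injI)
    have "swap_vars (XVar i) w P = (\<Prod>k=1..Suc m. \<Prod>j=1..l. x_var (transpose i (Suc m) k) - y_var j)"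
      unfolding P_def w_def swap_vars.prod swap_vars.diff swap_vars_xy transpose_inj[OF inj]
      by (simp add: transpose_def)
    also have "\<dots> = P"
      unfolding P_def by (rule prod_transpose[where f = "\<lambda>k. \<Prod>j=1..l. x_var k -
        y_var j"]) (use i in auto)
    finally have "swap_vars (XVar i) w P = P" .
    moreover have "swap_vars (XVar i) w (vandermonde y_var l) = vandermonde y_var l"
      unfolding w_def swap_vars.vandermonde swap_vars_xy by (simp add: transpose_def)
    moreover have "swap_vars (XVar i) w (vandermonde x_var (Suc m)) = - vandermonde x_var (Suc m)"
      unfolding w_def by (rule swap_vars_vandermonde_xy[OF inj]) (use i in auto)
    ultimately show ?thesis
      by (simp add: R_def swap_vars.mult swap_vars.power swap_vars.uminus)
  qed
  then have "moment_map (insert w (xy_vars m l)) A (vandermonde x_var m * xy w ^ n * R) = 0"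
    unfolding w_def using \<open>n < m\<close>
    by (intro moment_map_vandermonde_eq_0[where x = XVar]) (auto intro: injI A simp: xy_vars_def)
  then show ?thesis unfolding eq .
qed

lemma p_kernel_orthogonal_y:
  fixes A :: "xy_var \<Rightarrow> int \<Rightarrow> cd_ring"
  assumes A: "\<And>i j. A (YVar i) = A (YVar j)" and "n < l"
  defines "w \<equiv> YVar (Suc l)"
  shows "moment_map (insert w (xy_vars m l)) A (p_kernel m l * (\<Prod>v\<in>xy_vars m l. xy w - xy v) *
    xy w ^ n) = 0"
proof -
  define P where "P = (\<Prod>j=1..Suc l. \<Prod>i=1..m. x_var i - y_var j)"
  define R where "R = (-1) ^ (l * (l + 1) div 2) * (-1) ^ m * (-1) ^ l * vandermonde y_var (Suc l) *
    (vandermonde x_var m)\<^sup>2 * P"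
  have P': "P = (\<Prod>i=1..m. \<Prod>j=1..l. x_var i - y_var j) * (\<Prod>i=1..m. x_var i - y_var (Suc l))"
    unfolding P_def by (subst prod.swap) (simp add: prod.distrib)
  have eq: "p_kernel m l * (\<Prod>v\<in>xy_vars m l. xy w - xy v) * xy w ^ n =
    vandermonde y_var l * xy w ^ n * R"
    unfolding p_kernel_vandermonde prod_xy_vars w_def prod_diff_flip[where u =
      y_var and w = "y_var (Suc l)"]
      prod_diff_flip[where u = x_var] R_def P'
    by (simp add: vandermonde_Suc power2_eq_square mult_ac)
  have "swap_vars (YVar i) w R = - R" if i: "i \<in> {1..l}" for i
  proof -
    have inj: "inj YVar" by (auto intro: injI)
    have "swap_vars (YVar i) w P = (\<Prod>k=1..Suc l. \<Prod>h=1..m. x_var h - y_var (transpose i (Suc l) k))"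
      unfolding P_def w_def swap_vars.prod swap_vars.diff swap_vars_xy transpose_inj[OF inj]
      by (simp add: transpose_def)
    also have "\<dots> = P"
      unfolding P_def by (rule prod_transpose[where f = "\<lambda>k. \<Prod>h=1..m. x_var h -
        y_var k"]) (use i in auto)
    finally have "swap_vars (YVar i) w P = P" .
    moreover have "swap_vars (YVar i) w (vandermonde x_var m) = vandermonde x_var m"
      unfolding w_def swap_vars.vandermonde swap_vars_xy by (simp add: transpose_def)
    moreover have "swap_vars (YVar i) w (vandermonde y_var (Suc l)) = - vandermonde y_var (Suc l)"
      unfolding w_def by (rule swap_vars_vandermonde_xy[OF inj]) (use i in auto)
    ultimately show ?thesis
      by (simp add: R_def swap_vars.mult swap_vars.power swap_vars.uminus)
  qed
  then have "moment_map (insert w (xy_vars m l)) A (vandermonde y_var l * xy w ^ n * R) = 0"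
    unfolding w_def using \<open>n < l\<close>
    by (intro moment_map_vandermonde_eq_0[where x = YVar]) (auto intro: injI A simp: xy_vars_def)
  then show ?thesis unfolding eq .
qed

section \<open>The tau-function as a value of the moment functional\<close>

text \<open>
  The moments \<open>Res\<^sub>x C(x) x\<^sup>n\<close> and \<open>Res\<^sub>y D(y) y\<^sup>n\<close> of the two series \<open>C\<^bsup>(\<alpha>-\<beta>)\<^esup>\<close> and
  \<open>D\<^bsup>(\<alpha>)\<^esup>\<close>.
\<close>

definition cd_moment :: "int \<Rightarrow> int \<Rightarrow> xy_var \<Rightarrow> int \<Rightarrow> cd_ring" where
  "cd_moment \<alpha> \<beta> v n = (case v of XVar i \<Rightarrow> c_var (\<alpha> - \<beta> + n) | YVar i \<Rightarrow> d_var (\<alpha> + n))"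

lemma foldr_fdist_res:
  assumes "distinct vs"
  shows "foldr fdist_res vs F e =
    (if \<forall>v\<in>set vs. Poly_Mapping.lookup e v = 0
     then F (e - (\<Sum>v\<in>set vs. Poly_Mapping.single v 1)) else 0)"
  using assms
proof (induction vs arbitrary: e)
  case (Cons v vs)
  then show ?case
    by (auto simp: fdist_res_def lookup_minus lookup_single when_def diff_diff_eq)
qed simp

text \<open>
  The hypothesis on \<open>B\<close> and \<open>A\<close> says that the coefficient of \<open>v\<^bsup>-1-n\<^esup>\<close> in the series of \<open>v\<close> is the
  \<open>n\<close>-th moment.
\<close>

lemma iterated_res_moments:
  assumes "distinct vs" "set vs = V" and p: "int_laurent V p"
    and A: "\<And>v n. v \<in> V \<Longrightarrow> B v (- 1 - n) = A v n"
  shows "iterated_res vs (fdist_mult (fdist_prod V B) p) = moment_map V A p"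
proof -
  let ?s = "\<Sum>v\<in>V. Poly_Mapping.single v (1::int)"
  have fin: "finite V" using assms(2) by auto
  have s: "Poly_Mapping.lookup ?s v = of_bool (v \<in> V)" for v
    using fin by (simp add: lookup_sum lookup_single when_def)
  have "fdist_prod V B (- ?s - e) = monomial_value V A e" if "e \<in> Poly_Mapping.keys p" for e
  proof -
    have "Poly_Mapping.lookup e v = 0" if "v \<notin> V" for v
      using int_laurent_keys[OF p \<open>e \<in> _\<close>] that by (auto simp: in_keys_iff)
    then have "Poly_Mapping.lookup (- ?s - e) v = 0" if "v \<notin> V" for v
      using that by (simp add: lookup_minus s)
    then have "Poly_Mapping.keys (- ?s - e) \<subseteq> V"
      unfolding in_keys_iff subset_iff by blast
    then show ?thesis
      by (auto simp: fdist_prod_def monomial_value_def lookup_minus s A intro!: prod.cong)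
  qed
  then have "fdist_mult (fdist_prod V B) p (- ?s) = moment_map V A p"
    by (simp add: fdist_mult_def moment_map_def lin_ext_def mult.commute)
  then show ?thesis
    by (simp add: iterated_res_def foldr_fdist_res[OF assms(1)] assms(2))
qed

lemma tau_eq_moment_map:
  "tau \<alpha> \<beta> k l = scalar (1 / (fact (k - l) * fact l)) *
     moment_map (xy_vars (k - l) l) (cd_moment \<alpha> \<beta>) (p_kernel (k - l) l)"
proof -
  let ?m = "k - l" and ?vs = "map XVar [1..<Suc (k - l)] @ map YVar [1..<Suc l]"
  have "distinct ?vs"
    by (auto simp: distinct_map intro: inj_onI)
  moreover have "set ?vs = xy_vars ?m l"
    by (auto simp: xy_vars_def)
  moreover have "CD_series \<alpha> \<beta> v (- 1 - n) = cd_moment \<alpha> \<beta> v n" for v n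
    by (cases v) (simp_all add: CD_series_def cd_moment_def C_series_def D_series_def add.commute)
  ultimately have "iterated_res ?vs (fdist_mult (fdist_prod (xy_vars ?m l) (CD_series \<alpha> \<beta>))
    (p_kernel ?m l))
     = moment_map (xy_vars ?m l) (cd_moment \<alpha> \<beta>) (p_kernel ?m l)"
    by (intro iterated_res_moments int_laurent_p_kernel)
  then show ?thesis
    unfolding tau_def xy_vars_def by simp
qed

lemma hom_moment_map:
  assumes "comm_ring_1_hom h" 
  shows "h (moment_map V A p) = lin_ext h (monomial_value V (\<lambda>v n. h (A v n))) p"
proof -
  interpret comm_ring_1_hom h by fact
  show ?thesis by (simp add: moment_map_def lin_ext_def monomial_value_def sum prod mult)
qed

text \<open>Integer coefficients have only one image under ring homomorphisms to a given ring.\<close>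

lemma lin_ext_int_laurent:
  assumes "comm_ring_1_hom h" "comm_ring_1_hom g" "int_laurent V p"
  shows "lin_ext h \<Phi> p = lin_ext g \<Phi> p"
proof -
  interpret h: comm_ring_1_hom h by fact
  interpret g: comm_ring_1_hom g by fact
  have "h (Poly_Mapping.lookup p e) = g (Poly_Mapping.lookup p e)" for e
    using int_laurent_lookup[OF assms(3), of e] by (auto elim!: Ints_cases simp: h.of_int g.of_int)
  then show ?thesis by (simp add: lin_ext_def)
qed

lemma subst_coeff_hom: "comm_ring_1_hom (subst_coeff \<phi>)"
proof
  show "subst_coeff \<phi> 1 = 1"
    using subst_coeff_single[of \<phi> 0 1] by (simp add: subst_monom_def scalar_def one_pCons)
qed (simp_all add: subst_coeff_add subst_coeff_mult)

lemma const_hom: "comm_ring_1_hom (\<lambda>c. [:c:])"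
  by unfold_locales (simp_all add: one_pCons)

lemma subst_coeff_indet: "subst_coeff \<phi> (indet v) = \<phi> v"
  using subst_hom_indet[of \<phi> v] by (simp add: subst_hom_pCons)

section \<open>The tau-function does not vanish\<close>

lemma scalar_eq_0_iff: "scalar a = 0 \<longleftrightarrow> a = 0"
proof -
  have "Poly_Mapping.lookup (scalar a) 0 = a" by (simp add: scalar_def)
  moreover have "scalar 0 = 0" by (simp add: scalar_def)
  ultimately show ?thesis by force
qed

text \<open>Real numbers as constant polynomials.\<close>

definition real_scalar :: "real \<Rightarrow> cd_ring" where
  "real_scalar r = scalar (of_real r)"

interpretation real_scalar: comm_ring_1_hom real_scalar
  by unfold_locales (simp_all add: real_scalar_def scalar_def single_add mult_single)

lemma real_scalar_eq_0_iff: "real_scalar r = 0 \<longleftrightarrow> r = 0"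
  by (simp add: real_scalar_def scalar_eq_0_iff)

lemma moment_map_hom:
  assumes "\<And>v i j. v \<in> V \<Longrightarrow> A v (i + j) = A v i * A v j" "\<And>v. v \<in> V \<Longrightarrow> A v 0 = 1"
  shows "comm_ring_1_hom (moment_map V A)"
proof
  show "moment_map V A 1 = 1"
    using moment_map_single[of V A 0 1] assms(2) by (simp add: monomial_value_def)
qed (simp_all add: moment_map_add moment_map_mult assms(1))

lemma moment_map_xy:
  assumes "finite V" "v \<in> V" "\<And>v. v \<in> V \<Longrightarrow> A v 0 = 1"
  shows "moment_map V A (xy v) = A v 1"
proof -
  have "monomial_value V A (Poly_Mapping.single v 1) = (\<Prod>u\<in>V. if u = v then A v 1 else 1)"
    unfolding monomial_value_def by (rule prod.cong) (auto simp: lookup_single assms(3))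
  also have "\<dots> = A v 1" using assms by simp
  finally show ?thesis by (simp add: xy_def moment_map_single)
qed

lemma vandermonde_nonzero:
  assumes "inj_on u {1..m}"
  shows "vandermonde u m \<noteq> (0::'a::idom)"
proof -
  have "u i \<noteq> u j" if "j \<in> {1..m}" "i \<in> {1..<j}" for i j
    using inj_onD[OF assms, of i j] that by auto
  then show ?thesis by (auto simp: vandermonde_def)
qed

text \<open>
  The value of the kernel \<open>p\<^bsub>m,l\<^esub>\<close>, without its sign
  factor \<open>(-1)\<^bsup>l(l+1)/2\<^esup>\<close>, at the point where each variable \<open>v\<close> has
  the value \<open>f v\<close>.
\<close>

definition kernel_value :: "nat \<Rightarrow> nat \<Rightarrow> (xy_var \<Rightarrow> nat) \<Rightarrow> real" where
  "kernel_value m l f = (vandermonde (\<lambda>i. real (f (XVar i))) m)\<^sup>2 *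
    (vandermonde (\<lambda>j. real (f (YVar j))) l)\<^sup>2
     * (\<Prod>i=1..m. \<Prod>j=1..l. real (f (XVar i)) - real (f (YVar j)))"

lemma moment_map_p_kernel_point:
  assumes f: "\<And>v. v \<in> xy_vars m l \<Longrightarrow> f v > 0"
  shows "moment_map (xy_vars m l) (\<lambda>v n. real_scalar (real (f v) powi n)) (p_kernel m l) =
    (-1) ^ (l * (l + 1) div 2) * real_scalar (kernel_value m l f)"
proof -
  let ?V = "xy_vars m l"
  define L where "L = moment_map ?V (\<lambda>v n. real_scalar (real (f v) powi n))"
  interpret L: comm_ring_1_hom L
    unfolding L_def
    by (rule moment_map_hom) (use f in \<open>auto simp: power_int_add real_scalar.mult real_scalar.one\<close>)
  have xy: "L (xy v) = real_scalar (real (f v))" if "v \<in> ?V" for v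
    unfolding L_def using that by (subst moment_map_xy) (auto simp: real_scalar.one)
  have "L (vandermonde x_var m) = vandermonde (\<lambda>i. real_scalar (real (f (XVar i)))) m"
    unfolding L.vandermonde by (rule vandermonde_cong) (simp add: xy xy_vars_def)
  moreover have "L (vandermonde y_var l) = vandermonde (\<lambda>i. real_scalar (real (f (YVar i)))) l"
    unfolding L.vandermonde by (rule vandermonde_cong) (simp add: xy xy_vars_def)
  moreover have "L (\<Prod>i=1..m. \<Prod>j=1..l. x_var i - y_var j) =
      (\<Prod>i=1..m. \<Prod>j=1..l. real_scalar (real (f (XVar i))) - real_scalar (real (f (YVar j))))"
    unfolding L.prod L.diff by (intro prod.cong refl) (simp add: xy xy_vars_def)
  ultimately have "L (p_kernel m l) = (-1) ^ (l * (l + 1) div 2) * real_scalar (kernel_value m l f)"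
    unfolding p_kernel_vandermonde kernel_value_def
    by (simp add: L.mult L.power L.uminus L.one real_scalar.mult real_scalar.power
      real_scalar.vandermonde
        real_scalar.prod real_scalar.diff)
  then show ?thesis by (simp add: L_def)
qed

text \<open>Moments that are sums over points make the functional a sum over all choices of points.\<close>

lemma moment_map_power_sums:
  assumes "finite V" "\<And>v. v \<in> V \<Longrightarrow> finite (S v)"
  shows "moment_map V (\<lambda>v n. \<Sum>s\<in>S v. B s n) p = (\<Sum>f\<in>PiE V S. moment_map V (\<lambda>v. B (f v)) p)"
proof -
  have "monomial_value V (\<lambda>v n. \<Sum>s\<in>S v. B s n) e = (\<Sum>f\<in>PiE V S. monomial_value V (\<lambda>v. B (f v)) e)"
    for e
    unfolding monomial_value_def by (rule prod_sum_PiE) (use assms in auto)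
  then show ?thesis
    by (simp add: moment_map_def lin_ext_def sum_distrib_left sum.swap[of _ _ "Poly_Mapping.keys
      p"])
qed

text \<open>
  All \<open>x\<close>-points exceed all \<open>y\<close>-points, so the mixed product is positive and the squares are
  nonnegative; for an injective assignment of points the squares are positive as well.
\<close>

lemma kernel_value_sum_pos:
  fixes m l :: nat
  defines "S \<equiv> case_xy_var (\<lambda>_. {l + 1..l + m}) (\<lambda>_. {1..l})"
  shows "(\<Sum>f\<in>PiE (xy_vars m l) S. kernel_value m l f) > 0"
proof -
  let ?V = "xy_vars m l"
  define f0 where "f0 = restrict (case_xy_var (\<lambda>i. l + i) (\<lambda>j. j)) ?V"
  have x: "XVar i \<in> ?V" if "i \<in> {1..m}" for i using that by (auto simp: xy_vars_def)
  have y: "YVar j \<in> ?V" if "j \<in> {1..l}" for j using that by (auto simp: xy_vars_def)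
  have fin: "finite (PiE ?V S)" by (intro finite_PiE) (auto simp: S_def split: xy_var.split)
  have f0: "f0 \<in> PiE ?V S" by (auto simp: f0_def S_def xy_vars_def)
  have less: "real (f (YVar j)) < real (f (XVar i))"
    if "f \<in> PiE ?V S" "i \<in> {1..m}" "j \<in> {1..l}" for f i j
    using PiE_mem[OF that(1) x[OF that(2)]] PiE_mem[OF that(1) y[OF that(3)]] by (simp add: S_def)
  have nonneg: "kernel_value m l f \<ge> 0" if "f \<in> PiE ?V S" for f
    unfolding kernel_value_def using less[OF that]
    by (intro mult_nonneg_nonneg prod_nonneg) (auto intro: less_imp_le)
  have "inj_on (\<lambda>i. real (f0 (XVar i))) {1..m}" "inj_on (\<lambda>j. real (f0 (YVar j))) {1..l}"
    using x y by (auto intro!: inj_onI simp: f0_def)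
  then have "kernel_value m l f0 > 0"
    unfolding kernel_value_def using less[OF f0]
    by (intro mult_pos_pos prod_pos zero_less_power2[THEN iffD2] vandermonde_nonzero) auto
  then show ?thesis
    using sum_pos2[OF fin f0] nonneg by blast
qed

lemma tau_nonzero: "tau \<alpha> \<beta> k l \<noteq> 0"
proof -
  define m where "m = k - l"
  let ?V = "xy_vars m l"
  define S where "S = case_xy_var (\<lambda>_. {l + 1..l + m}) (\<lambda>_. {1..l})"
  define B where "B s n = real_scalar (real s powi n)" for s n
  \<comment> \<open>The index of a variable is its order as a moment plus \<open>\<alpha> - \<beta>\<close> or \<open>\<alpha>\<close>.\<close>
  define \<psi> where "\<psi> v = (case v of
      CVar i \<Rightarrow> [:\<Sum>s\<in>{l + 1..l + m}. B s (i - (\<alpha> - \<beta>)):]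
    | DVar i \<Rightarrow> [:\<Sum>s\<in>{1..l}. B s (i - \<alpha>):])" for v
  have "subst_coeff \<psi> (cd_moment \<alpha> \<beta> v n) = [:\<Sum>s\<in>S v. B s n:]" for v n
    by (cases v) (simp_all add: cd_moment_def subst_coeff_indet \<psi>_def S_def)
  then have "subst_coeff \<psi> (moment_map ?V (cd_moment \<alpha> \<beta>) (p_kernel m l)) =
      lin_ext (\<lambda>c. [:c:]) (monomial_value ?V (\<lambda>v n. [:\<Sum>s\<in>S v. B s n:])) (p_kernel m l)"
    by (simp add: hom_moment_map[OF subst_coeff_hom]
        lin_ext_int_laurent[OF subst_coeff_hom const_hom int_laurent_p_kernel])
  also have "\<dots> = [:moment_map ?V (\<lambda>v n. \<Sum>s\<in>S v. B s n) (p_kernel m l):]"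
    by (rule hom_moment_map[OF const_hom, symmetric])
  also have "moment_map ?V (\<lambda>v n. \<Sum>s\<in>S v. B s n) (p_kernel m l) =
      (\<Sum>f\<in>PiE ?V S. moment_map ?V (\<lambda>v. B (f v)) (p_kernel m l))"
    by (rule moment_map_power_sums) (auto simp: S_def split: xy_var.split)
  also have "\<dots> = (\<Sum>f\<in>PiE ?V S. (-1) ^ (l * (l + 1) div 2) * real_scalar (kernel_value m l f))"
  proof (rule sum.cong[OF refl])
    fix f assume f: "f \<in> PiE ?V S"
    have "f v > 0" if "v \<in> ?V" for v
      using PiE_mem[OF f that] by (auto simp: S_def split: xy_var.splits)
    then show "moment_map ?V (\<lambda>v. B (f v)) (p_kernel m l) =
        (-1) ^ (l * (l + 1) div 2) * real_scalar (kernel_value m l f)"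
      unfolding B_def by (rule moment_map_p_kernel_point)
  qed
  also have "\<dots> = (-1) ^ (l * (l + 1) div 2) * real_scalar (\<Sum>f\<in>PiE ?V S. kernel_value m l f)"
    by (simp add: sum_distrib_left real_scalar.sum)
  finally have "moment_map ?V (cd_moment \<alpha> \<beta>) (p_kernel m l) \<noteq> 0"
    using kernel_value_sum_pos[of m l] by (auto simp: S_def real_scalar_eq_0_iff)
  moreover have "scalar (1 / (fact m * fact l)) \<noteq> 0"
    by (simp add: scalar_eq_0_iff)
  ultimately show ?thesis
    unfolding tau_eq_moment_map m_def by simp
qed

section \<open>The shift fields\<close>

lemma shift_hom: "comm_ring_1_hom (\<lambda>f. S_c (S_d [:f:]))"
proof
  interpret S: comm_ring_1_hom "subst_coeff \<phi>" for \<phi> by (rule subst_coeff_hom)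
  show "S_c (S_d [:1:]) = 1"
    by (simp add: S_c_def S_d_def subst_hom_pCons S.one one_pCons)
  fix a b :: cd_ring
  have "[:a + b:] = [:a:] + [:b:]" "[:a * b:] = [:a:] * [:b:]" by (simp_all add: mult.commute)
  then show "S_c (S_d [:a + b:]) = S_c (S_d [:a:]) + S_c (S_d [:b:])"
    and "S_c (S_d [:a * b:]) = S_c (S_d [:a:]) * S_c (S_d [:b:])"
    by (simp_all only: S_c_def S_d_def subst_hom_add subst_hom_mult)
qed

lemma shift_scalar: "S_c (S_d [:scalar a:]) = [:scalar a:]"
  by (simp only: S_c_def S_d_def subst_hom_scalar)

lemma shift_cd_moment:
  "S_c (S_d [:cd_moment \<alpha> \<beta> v n:]) = [:cd_moment \<alpha> \<beta> v n, - cd_moment \<alpha> \<beta> v (n + 1):]"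
proof (cases v)
  case (XVar i)
  then show ?thesis by (simp add: cd_moment_def S_d_indets S_c_indets add.assoc)
next
  case (YVar i)
  interpret S: comm_ring_1_hom "subst_coeff \<phi>" for \<phi> by (rule subst_coeff_hom)
  have "S_c [:d_var j, - d_var (j + 1):] = [:d_var j, - d_var (j + 1):]" for j
    by (simp add: S_c_def subst_hom_pCons S.uminus subst_coeff_indet monom_Suc)
  from this[of "\<alpha> + n"] show ?thesis using YVar by (simp add: cd_moment_def S_d_indets add.assoc)
qed

text \<open>Only the moments are shifted, since the coefficients of \<open>p\<close> are integers.\<close>

lemma shift_moment_map:
  assumes "int_laurent W p"
  shows "S_c (S_d [:moment_map V (cd_moment \<alpha> \<beta>) p:]) =
    lin_ext (\<lambda>c. [:c:]) (monomial_value V (\<lambda>v n. [:cd_moment \<alpha> \<beta> v n, - cd_moment \<alpha> \<beta> v (n +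
      1):])) p"
  using hom_moment_map[OF shift_hom, of V "cd_moment \<alpha> \<beta>" p]
  by (simp add: shift_cd_moment lin_ext_int_laurent[OF shift_hom const_hom assms])

section \<open>Reversal of the shifted tau-function\<close>

lemma of_poly_z_pCons: "of_poly_z (pCons a p) = fls_const a + fls_X_inv * of_poly_z p"
  by (simp add: of_poly_z_def map_poly_pCons)

interpretation of_poly_z: comm_ring_1_hom of_poly_z
proof
  show 1: "of_poly_z 1 = 1"
    by (simp add: one_pCons of_poly_z_pCons) (simp add: of_poly_z_def)
  have add: "of_poly_z (p + q) = of_poly_z p + of_poly_z q" for p q
  proof (induction p q rule: poly_induct2)
    case (pCons a p b q)
    then show ?case by (simp add: of_poly_z_pCons algebra_simps flip: fls_plus_const)
  qed (simp add: of_poly_z_def)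
  then show "of_poly_z (p + q) = of_poly_z p + of_poly_z q" for p q .
  have smult: "of_poly_z (smult a q) = fls_const a * of_poly_z q" for a q
    by (induction q) (simp_all add: of_poly_z_pCons algebra_simps, simp add: of_poly_z_def)
  show "of_poly_z (p * q) = of_poly_z p * of_poly_z q" for p q
    by (induction p) (simp_all add: of_poly_z_pCons add smult algebra_simps, simp_all add:
      of_poly_z_def)
qed

lemma of_poly_z_const: "of_poly_z [:a:] = fls_const a"
  by (simp add: of_poly_z_pCons of_poly_z.zero)

lemma of_poly_z_monom: "of_poly_z (monom 1 n) = fls_X_inv ^ n"
proof (induction n)
  case 0
  then show ?case using of_poly_z.one by (simp add: monom_0 one_pCons)
next
  case (Suc n)
  then show ?case by (simp add: monom_Suc of_poly_z_pCons)
qed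

text \<open>The inclusion of \<open>\<complex>[c\<^sub>i, d\<^sub>i][z]\<close> into \<open>K((z\<^sup>-\<^sup>1))\<close>.\<close>

definition cd_poly_z :: "cd_ring poly \<Rightarrow> cd_field fls" where
  "cd_poly_z q = of_poly_z (fract_poly q)"

interpretation cd_poly_z: comm_ring_1_hom cd_poly_z
  by unfold_locales (simp_all add: cd_poly_z_def of_poly_z.add of_poly_z.mult of_poly_z.one)

lemma cd_poly_z_linear: "cd_poly_z [:a, b:] =
  fls_const (to_fract a) + fls_X_inv * fls_const (to_fract b)"
  by (simp add: cd_poly_z_def map_poly_pCons of_poly_z_pCons of_poly_z.zero)

lemma cd_poly_z_const: "cd_poly_z [:a:] = fls_const (to_fract a)"
  by (simp add: cd_poly_z_def map_poly_pCons of_poly_z_const)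

interpretation of_poly_z_inv: comm_ring_1_hom of_poly_z_inv
  by unfold_locales (simp_all add: of_poly_z_inv_def fps_of_poly_add fps_of_poly_mult
    fls_times_fps_to_fls)

lemma of_poly_z_inv_linear:
  "of_poly_z_inv [:a, b:] = fls_const (to_fract a) + fls_X * fls_const (to_fract b)"
  by (simp add: of_poly_z_inv_def map_poly_pCons fps_of_poly_pCons fps_of_poly_const
      fls_times_fps_to_fls fls_X_def)

lemma of_poly_z_inv_const: "of_poly_z_inv [:a:] = fls_const (to_fract a)"
  using of_poly_z_inv_linear[of a 0] by simp

text \<open>
  The polynomial \<open>\<Prod>\<^bsub>v \<in> V\<^esub> (A v (e v) z - A v (e v + 1))\<close>, which is \<open>z\<^bsup>card V\<^esup>\<close> times the shifted
  value \<open>\<Prod>\<^bsub>v \<in> V\<^esub> (A v (e v) - A v (e v + 1) z\<^sup>-\<^sup>1)\<close> of the monomial with exponents \<open>e\<close>.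
\<close>

definition reversed_monomial :: "xy_var set \<Rightarrow> (xy_var \<Rightarrow> int \<Rightarrow> cd_ring) \<Rightarrow> (xy_var \<Rightarrow>\<^sub>0 int) \<Rightarrow>
  cd_ring poly" where
  "reversed_monomial V A = monomial_value V (\<lambda>v n. [:- A v (n + 1), A v n:])"

lemma cd_poly_z_reverse:
  "cd_poly_z (lin_ext (\<lambda>c. [:c:]) (reversed_monomial V A) p) =
   fls_X_inv ^ card V * of_poly_z_inv (lin_ext (\<lambda>c. [:c:]) (monomial_value V (\<lambda>v n. [:A v n, -
     A v (n + 1):])) p)"
proof -
  have "fls_X_inv * fls_X = (1 :: cd_field fls)"
    unfolding fls_inverse_X[symmetric] by (rule left_inverse) simp
  then have "fls_X_inv * (fls_X * F) = F" for F :: "cd_field fls"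
    by (simp only: mult.assoc[symmetric] mult_1_left)
  then have "cd_poly_z [:- b, a:] = fls_X_inv * of_poly_z_inv [:a, - b:]" for a b
    by (simp only: cd_poly_z_linear of_poly_z_inv_linear distrib_left add.commute)
  then have "cd_poly_z (reversed_monomial V A e) =
      fls_X_inv ^ card V * of_poly_z_inv (monomial_value V (\<lambda>v n. [:A v n, - A v (n + 1):]) e)"
        for e
    by (simp add: reversed_monomial_def monomial_value_def cd_poly_z.prod of_poly_z_inv.prod
      prod.distrib)
  then show ?thesis
    by (simp add: lin_ext_def cd_poly_z.sum cd_poly_z.mult of_poly_z_inv.sum of_poly_z_inv.mult
        cd_poly_z_const of_poly_z_inv_const sum_distrib_left mult.left_commute del: mult_pCons_left)
qed

text \<open>The coefficients \<open>a v\<close> may be \<open>0\<close>, so the degree is only bounded.\<close>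

lemma prod_linear_top:
  assumes "finite V"
  shows "degree (\<Prod>v\<in>V. [:b v, a v :: 'a::comm_ring_1:]) \<le> card V \<and>
    coeff (\<Prod>v\<in>V. [:b v, a v:]) (card V) = (\<Prod>v\<in>V. a v)"
  using assms
proof (induction V)
  case (insert u V)
  let ?q = "\<Prod>v\<in>V. [:b v, a v:]"
  have eq: "(\<Prod>v\<in>insert u V. [:b v, a v:]) = smult (b u) ?q + pCons 0 (smult (a u) ?q)"
    using insert.hyps by simp
  have "degree (smult (b u) ?q) \<le> Suc (card V)" "degree (pCons 0 (smult (a u) ?q)) \<le> Suc (card V)"
    using insert.IH degree_smult_le[of "b u" ?q] degree_smult_le[of "a u" ?q]
      degree_pCons_le[of 0 "smult (a u) ?q"] by linarith+
  moreover have "coeff ?q (Suc (card V)) = 0"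
    using insert.IH by (intro coeff_eq_0) simp
  ultimately show ?case
    using insert.IH insert.hyps unfolding eq by (simp add: degree_add_le)
qed simp

lemma reversed_monomial_top:
  assumes "finite V"
  shows "degree (lin_ext (\<lambda>c. [:c:]) (reversed_monomial V A) p) \<le> card V"
    and "coeff (lin_ext (\<lambda>c. [:c:]) (reversed_monomial V A) p) (card V) = moment_map V A p"
proof -
  have "degree ([:c:] * reversed_monomial V A e) \<le> card V" for c e
  proof -
    have "degree (reversed_monomial V A e) \<le> card V"
      unfolding reversed_monomial_def monomial_value_def
        by (rule prod_linear_top[OF assms, THEN conjunct1])
    then show ?thesis using degree_smult_le[of c "reversed_monomial V A e"] by simp
  qed
  then show "degree (lin_ext (\<lambda>c. [:c:]) (reversed_monomial V A) p) \<le> card V"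
    unfolding lin_ext_def by (intro degree_sum_le finite_keys)
  show "coeff (lin_ext (\<lambda>c. [:c:]) (reversed_monomial V A) p) (card V) = moment_map V A p"
    by (simp add: lin_ext_def reversed_monomial_def monomial_value_def moment_map_def coeff_sum
        prod_linear_top[OF assms, THEN conjunct2])
qed

section \<open>Pairing with powers of \<open>z\<close>\<close>

text \<open>The pairing of \<open>q\<close> with \<open>z\<^sup>n\<close> for the moments \<open>a\<^sub>0, a\<^sub>1, \<dots>\<close>.\<close>

definition pair_moment :: "(nat \<Rightarrow> cd_ring) \<Rightarrow> nat \<Rightarrow> cd_ring poly \<Rightarrow> cd_field" where
  "pair_moment a n q = Res_z (neg_series a * cd_poly_z q * fls_X_inv ^ n)"

lemma pair_moment_add: "pair_moment a n (p + q) = pair_moment a n p + pair_moment a n q"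
  by (simp add: pair_moment_def cd_poly_z.add Res_z_def algebra_simps)

lemma pair_moment_diff: "pair_moment a n (p - q) = pair_moment a n p - pair_moment a n q"
  by (simp add: pair_moment_def cd_poly_z.diff Res_z_def algebra_simps)

lemma pair_moment_sum: "pair_moment a n (\<Sum>i\<in>I. f i) = (\<Sum>i\<in>I. pair_moment a n (f i))"
proof (induction I rule: infinite_finite_induct)
  case (insert i I)
  then show ?case by (simp add: pair_moment_add)
qed (simp_all add: pair_moment_def cd_poly_z.zero Res_z_def)

lemma pair_moment_const_mult: "pair_moment a n ([:c:] * q) = to_fract c * pair_moment a n q"
  unfolding pair_moment_def cd_poly_z.mult cd_poly_z_const Res_z_def
  by (simp only: mult.assoc mult.left_commute[of _ "fls_const _"] fls_mult_const_nth)

lemma pair_moment_shift: "pair_moment a n ([:0, 1:] * q) = pair_moment a (Suc n) q"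
proof -
  have "cd_poly_z [:0, 1:] = fls_X_inv" by (simp add: cd_poly_z_linear)
  then show ?thesis by (simp only: pair_moment_def cd_poly_z.mult power_Suc mult_ac)
qed

lemma pair_moment_1: "pair_moment a n 1 = to_fract (a n)"
  by (simp add: pair_moment_def cd_poly_z.one Res_z_def neg_series_def
    fls_X_inv_power_times_conv_shift
      mult.commute[of _ "fls_X_inv ^ n"] nat_add_distrib)

text \<open>
  The pairing is the value of the functional with \<open>z\<close> as an additional variable \<open>w\<close>. This is proved
  by induction on the set \<open>U\<close> of variables \<open>v\<close> whose factor \<open>w - v\<close> is present: adding \<open>u\<close> to
  \<open>U\<close> gives the difference of a term with \<open>n\<close> raised by one and a term with the exponent of
  \<open>u\<close> raised by one.
\<close>

lemma pair_moment_reversed_monomial_aux: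
  assumes V: "finite V" "w \<notin> V" "U \<subseteq> V" and a: "\<And>n. A w (int n) = a n"
    and e: "Poly_Mapping.lookup e w = 0"
  shows "pair_moment a n (\<Prod>v\<in>V. if v \<in> U then [:- A v (Poly_Mapping.lookup e v +
    1), A v (Poly_Mapping.lookup e v):]
       else [:A v (Poly_Mapping.lookup e v):]) =
     to_fract (moment_map (insert w V) A (Poly_Mapping.single e 1 * (\<Prod>v\<in>U. xy w - xy v) *
       xy w ^ n))"
proof -
  have "finite U" using V finite_subset by blast
  from this V(3) e show ?thesis
  proof (induction U arbitrary: e n)
    case empty
    have "(\<Prod>v\<in>V. [:A v (Poly_Mapping.lookup e v):]) = [:\<Prod>v\<in>V. A v (Poly_Mapping.lookup e v):] * 1"
      using comm_ring_1_hom.prod[OF const_hom, of "\<lambda>v. A v (Poly_Mapping.lookup e v)" V] by simp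
    then have "pair_moment a n (\<Prod>v\<in>V. [:A v (Poly_Mapping.lookup e v):]) =
        to_fract ((\<Prod>v\<in>V. A v (Poly_Mapping.lookup e v)) * a n)"
      by (simp only: pair_moment_const_mult pair_moment_1 to_fract_mult)
    also have "(\<Prod>v\<in>V. A v (Poly_Mapping.lookup e v)) * a n =
        monomial_value (insert w V) A (e + Poly_Mapping.single w (int n))"
    proof -
      have "(\<Prod>v\<in>V. A v (Poly_Mapping.lookup (e + Poly_Mapping.single w (int n)) v)) =
          (\<Prod>v\<in>V. A v (Poly_Mapping.lookup e v))"
        by (rule prod.cong) (use V in \<open>auto simp: lookup_add lookup_single when_def\<close>)
      then show ?thesis
        using V empty.prems by (simp add: monomial_value_def lookup_add a mult.commute)
    qed
    finally show ?case
      by (simp add: xy_power mult_single moment_map_single)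
  next
    case (insert u U)
    then have u: "u \<in> V" "u \<noteq> w" "U \<subseteq> V" "u \<notin> U" using V by auto
    let ?e' = "e + Poly_Mapping.single u 1"
    define F where "F U e v = (if v \<in> U then [:- A v (Poly_Mapping.lookup e v +
      1), A v (Poly_Mapping.lookup e v):]
       else [:A v (Poly_Mapping.lookup e v):])" for U e v
    have F: "F (insert u U) e v = F U e v" "F U ?e' v = F U e v" if "v \<noteq> u" for v
      using that by (auto simp: F_def lookup_add lookup_single when_def)
    have Fu: "F (insert u U) e u = [:0, 1:] * F U e u - F U ?e' u"
      using u by (simp add: F_def lookup_add)
    have "(\<Prod>v\<in>V. F (insert u U) e v) = [:0, 1:] * (\<Prod>v\<in>V. F U e v) - (\<Prod>v\<in>V. F U ?e' v)"
      using V u by (simp only: prod.remove[of V u] Fu) (simp add: F algebra_simps)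
    then have "pair_moment a n (\<Prod>v\<in>V. F (insert u U) e v) =
        pair_moment a (Suc n) (\<Prod>v\<in>V. F U e v) - pair_moment a n (\<Prod>v\<in>V. F U ?e' v)"
      by (simp only: pair_moment_diff pair_moment_shift)
    also have "\<dots> = to_fract (moment_map (insert w V) A (Poly_Mapping.single e 1 * (\<Prod>v\<in>U. xy w -
      xy v) * xy w ^ Suc n))
       - to_fract (moment_map (insert w V) A (Poly_Mapping.single ?e' 1 * (\<Prod>v\<in>U. xy w - xy v) *
         xy w ^ n))"
      unfolding F_def using insert.IH[OF u(3)] insert.prems u
      by (simp add: lookup_add lookup_single)
    also have "\<dots> = to_fract (moment_map (insert w V) A (Poly_Mapping.single e 1 *
      (\<Prod>v\<in>insert u U. xy w - xy v) * xy w ^ n))"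
    proof -
      have "Poly_Mapping.single ?e' 1 = Poly_Mapping.single e 1 *
        (xy u :: (xy_var, cd_ring) laurent_poly)"
        by (simp add: xy_def mult_single)
      then show ?thesis
        using insert.hyps by (simp add: algebra_simps flip: moment_map_diff to_fract_diff)
    qed
    finally show ?case unfolding F_def .
  qed
qed

lemma pair_moment_reversed_monomial:
  assumes V: "finite V" "w \<notin> V" and a: "\<And>n. A w (int n) = a n" and p: "int_laurent V p"
  shows "pair_moment a n (lin_ext (\<lambda>c. [:c:]) (reversed_monomial V A) p) =
    to_fract (moment_map (insert w V) A (p * (\<Prod>v\<in>V. xy w - xy v) * xy w ^ n))"
proof -
  let ?R = "(\<Prod>v\<in>V. xy w - xy v) * xy w ^ n"
  have "pair_moment a n ([:c:] * reversed_monomial V A e) =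
     to_fract (moment_map (insert w V) A (Poly_Mapping.single e c * ?R))"
    if e: "e \<in> Poly_Mapping.keys p" for e c
  proof -
    have "Poly_Mapping.lookup e w = 0"
      using int_laurent_keys[OF p e] V(2) by (auto simp: in_keys_iff)
    from pair_moment_reversed_monomial_aux[of V w V A a, OF V order.refl a this, of n]
    have 1: "pair_moment a n (reversed_monomial V A e) =
      to_fract (moment_map (insert w V) A (Poly_Mapping.single e 1 * ?R))"
      by (simp add: reversed_monomial_def monomial_value_def mult.assoc)
    have "moment_map W A (Poly_Mapping.single e c * q) =
      c * moment_map W A (Poly_Mapping.single e 1 * q)" for W q
      by (induction q rule: poly_mapping_add_induct)
        (simp_all add: mult_single moment_map_single moment_map_add algebra_simps)
    then show ?thesis by (simp only: pair_moment_const_mult 1 to_fract_mult)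
  qed
  then have "pair_moment a n (lin_ext (\<lambda>c. [:c:]) (reversed_monomial V A) p) =
     to_fract (\<Sum>e\<in>Poly_Mapping.keys p. moment_map (insert w V) A (Poly_Mapping.single e
       (Poly_Mapping.lookup p e) * ?R))"
    unfolding lin_ext_def pair_moment_sum by (simp del: mult_pCons_left)
  also have "(\<Sum>e\<in>Poly_Mapping.keys p. moment_map (insert w V) A (Poly_Mapping.single e
    (Poly_Mapping.lookup p e) * ?R))
     = moment_map (insert w V) A (p * ?R)"
    by (simp add: sum_monomials flip: moment_map_sum sum_distrib_right)
  finally show ?thesis by (simp add: mult.assoc)
qed

theorem mainTheorem3:
  fixes \<alpha> \<beta> :: int and k l :: nat
  assumes "l \<le> k"
  shows "\<exists>p :: cd_field poly.
           of_poly_z p = p_mop \<alpha> \<beta> k l \<and>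
           degree p = k \<and> lead_coeff p = 1 \<and>
           (\<forall>n < k - l. pairing_C \<alpha> \<beta> p (monom 1 n) = 0) \<and>
           (\<forall>n < l. pairing_D \<alpha> \<beta> p (monom 1 n) = 0)"
proof -
  define m where "m = k - l"
  define A where "A = cd_moment \<alpha> \<beta>"
  define V where "V = xy_vars m l"
  define s where "s = scalar (1 / (fact m * fact l))"
  define t where "t = tau \<alpha> \<beta> k l"
  define Q where "Q = lin_ext (\<lambda>c. [:c:]) (reversed_monomial V A) (p_kernel m l)"
  define p where "p = smult (1 / to_fract t) (fract_poly ([:s:] * Q))"
  have V: "finite V" "card V = k" using assms by (simp_all add: V_def m_def)
  have t: "t = s * moment_map V A (p_kernel m l)"
    unfolding t_def tau_eq_moment_map s_def m_def V_def A_def ..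
  have t0: "to_fract t \<noteq> 0" by (simp add: t_def tau_nonzero)

  have pz: "of_poly_z p = fls_const (1 / to_fract t) * cd_poly_z ([:s:] * Q)"
  proof -
    have "p = [:1 / to_fract t:] * fract_poly ([:s:] * Q)" by (simp add: p_def)
    then show ?thesis by (simp only: of_poly_z.mult of_poly_z_const cd_poly_z_def)
  qed
  have "S_c (S_d [:t:]) = [:s:] *
      lin_ext (\<lambda>c. [:c:]) (monomial_value V (\<lambda>v n. [:A v n, - A v (n + 1):])) (p_kernel m l)"
    unfolding t comm_ring_1_hom.mult[OF shift_hom] unfolding s_def A_def
    by (simp only: shift_scalar shift_moment_map[OF int_laurent_p_kernel])
  then have "of_poly_z p = p_mop \<alpha> \<beta> k l"
    unfolding pz p_mop_def t_def[symmetric] Q_def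
    by (simp only: cd_poly_z.mult cd_poly_z_reverse V(2) of_poly_z_inv.mult cd_poly_z_const
        of_poly_z_inv_const mult_ac)
  moreover have "coeff p k = 1"
    using reversed_monomial_top(2)[OF V(1), of A "p_kernel m l"] t0
    by (simp add: p_def Q_def[symmetric] V(2) t coeff_map_poly)
  moreover have "degree p \<le> k"
  proof (rule degree_le, intro allI impI)
    fix i assume "k < i"
    then have "coeff Q i = 0"
      unfolding Q_def using reversed_monomial_top(1)[OF V(1), of A "p_kernel m l"] V(2)
      by (intro coeff_eq_0) simp
    then show "coeff p i = 0" by (simp add: p_def coeff_map_poly)
  qed
  moreover have pair: "Res_z (neg_series a * of_poly_z p * of_poly_z (monom 1 n)) = 0"
    if "w \<notin> V" "\<And>n. A w (int n) = a n"
      "moment_map (insert w V) A (p_kernel m l * (\<Prod>v\<in>V. xy w - xy v) * xy w ^ n) = 0" for w a n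
  proof -
    have "pair_moment a n ([:s:] * Q) = 0"
      unfolding pair_moment_const_mult Q_def
      using that by (subst pair_moment_reversed_monomial[OF V(1)]) (auto simp: V_def
        int_laurent_p_kernel)
    moreover have "Res_z (neg_series a * of_poly_z p * of_poly_z (monom 1 n)) =
        1 / to_fract t * pair_moment a n ([:s:] * Q)"
      unfolding pz of_poly_z_monom pair_moment_def Res_z_def
      by (simp only: mult.assoc mult.left_commute[of _ "fls_const _"] fls_mult_const_nth)
    ultimately show ?thesis by simp
  qed
  moreover have "pairing_C \<alpha> \<beta> p (monom 1 n) = 0" if "n < k - l" for n
    unfolding pairing_C_def
  proof (rule pair)
    show "XVar (Suc m) \<notin> V" by (auto simp: V_def xy_vars_def)
    show "A (XVar (Suc m)) (int i) = c_var (\<alpha> - \<beta> + int i)" for i by (simp add: A_def cd_moment_def)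
    show "moment_map (insert (XVar (Suc m)) V) A (p_kernel m l * (\<Prod>v\<in>V. x_var (Suc m) - xy v) *
      x_var (Suc m) ^ n) = 0"
      unfolding V_def
      by (rule p_kernel_orthogonal_x) (use that in \<open>auto simp: A_def cd_moment_def m_def\<close>)
  qed
  moreover have "pairing_D \<alpha> \<beta> p (monom 1 n) = 0" if "n < l" for n
    unfolding pairing_D_def
  proof (rule pair)
    show "YVar (Suc l) \<notin> V" by (auto simp: V_def xy_vars_def)
    show "A (YVar (Suc l)) (int i) = d_var (\<alpha> + int i)" for i by (simp add: A_def cd_moment_def)
    show "moment_map (insert (YVar (Suc l)) V) A (p_kernel m l * (\<Prod>v\<in>V. y_var (Suc l) - xy v) *
      y_var (Suc l) ^ n) = 0"
      unfolding V_def
      by (rule p_kernel_orthogonal_y) (use that in \<open>auto simp: A_def cd_moment_def\<close>)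
  qed
  moreover have "degree p = k"
    using \<open>coeff p k = 1\<close> \<open>degree p \<le> k\<close> by (intro antisym le_degree) auto
  ultimately show ?thesis
    by (intro exI[of _ p]) auto
qed

end
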